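(* Let $P$ be an integer with $3\nmid P$, and let $\delta\ge 1$ be the integer with $3^{\delta}\,\Vert\, P^2+2$. Then the following hold. 1) Suppose $\delta=1$ and $k\in\mathbb{N}$. Then for every residue $b$ modulo $3^k$, $$v_{u}(3^k,b)=\begin{cases}3^{\lfloor k/2\rfloor}+2, & \text{if }b\equiv\pm u_{2\cdot 3^{2\lfloor(k-1)/4\rfloor+1}}\pmod{3^k},\\ 2\cdot 3^l+2, &\text{if }b\equiv\pm u_{2\cdot 3^{l-1}}\pmod{3^{2l+1}}\text{ for some }l\in\{1,\ldots,\lfloor(k-1)/2\rfloor\},\\ 2, &\text{otherwise,}\end{cases}$$ and $$v_{v}(3^k,b)=\begin{cases}3^{\lfloor k/2\rfloor}+2, & \text{if }b\equiv\pm 2\pmod{3^k},\\ 2\cdot 3^l+2, &\text{if }b\equiv\pm v_{4\cdot 3^{l-1}}\pmod{3^{2l+1}}\text{ for some }l\in\{1,\ldots,\lfloor(k-1)/2\rfloor\},\\ 2, &\text{otherwise.}\end{cases}$$ 2) Suppose $\delta\geq 2$ and $k\in\mathbb{N}$, $k\geq 2\delta-1$. Then for every residue $b$ modulo $3^k$, $$v_{u}(3^k,b)=\begin{cases}3^{\lfloor k/2\rfloor}, & \text{if }b\equiv\pm u_{2\cdot 3^{2\lfloor(k-2\delta+1)/4\rfloor+1}}\pmod{3^k},\\ 2\cdot 3^l, &\text{if }b\equiv\pm u_{2\cdot 3^{l-\delta}}\pmod{3^{2l+1}}\text{ for some }l\in\{\delta,\ldots,\lfloor(k-1)/2\rfloor\},\\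 2, &\text{if }b\equiv 0,\pm 1\pmod{3^\delta},\\ 0, &\text{otherwise,}\end{cases}$$ and $$v_{v}(3^k,b)=\begin{cases}3^{\lfloor k/2\rfloor}, & \text{if }b\equiv\pm 2\pmod{3^k},\\ 2\cdot 3^l, &\text{if }b\equiv\pm v_{4\cdot 3^{l-\delta}}\pmod{3^{2l+1}}\text{ for some }l\in\{\delta,\ldots,\lfloor(k-1)/2\rfloor\},\\ 2, &\text{if }b\equiv 0,\pm P\pmod{3^{\delta}},\\ 0, &\text{otherwise.}\end{cases}$$ 3) Suppose $\delta\geq 2$ and $k\in\mathbb{N}$, $\delta\leq k<2\delta-1$. Then for every residue $b$ modulo $3^k$, $$v_{u}(3^k,b)=\begin{cases}3^{k-\delta}, & \text{if }b\equiv\pm P\pmod{3^k},\\ 2, &\text{if }b\equiv 0,\pm 1\pmod{3^\delta},\\ 0, &\text{otherwise,}\end{cases}$$ and $$v_{v}(3^k,b)=\begin{cases}3^{k-\delta}, & \text{if }b\equiv\pm 2\pmod{3^k},\\ 2, &\text{if }b\equiv 0,\pm P\pmod{3^{\delta}},\\ 0, &\text{otherwise.}\end{cases}$$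
   Context: For an integer $P$, the sequences $(u_n)$ and $(v_n)$ are defined by $u_0=0$, $u_1=1$, $u_n=Pu_{n-1}+u_{n-2}$ and $v_0=2$, $v_1=P$, $v_n=Pv_{n-1}+v_{n-2}$ for $n\ge 2$. For a prime $p$, $p^k\,\Vert\, n$ means that $p^k$ is the highest power of $p$ dividing $n$. $\mathbb{N}$ is the set of positive integers. For $m\in\mathbb{N}$, $h_u(m)$ (resp. $h_v(m)$) is the length of the shortest period of $(u_n)$ (resp. $(v_n)$) modulo $m$, i.e. the least positive integer $h$ with $u_{n+h}\equiv u_n \pmod m$ (resp. $v_{n+h}\equiv v_n\pmod m$) for all $n\ge 0$. For an integer $b$, the two-argument counting functions (not to be confused with the terms $v_n$) are $v_u(m,b)=\#\{n : 0\le n<h_u(m),\ u_n\equiv b\pmod m\}$ and $v_v(m,b)=\#\{n : 0\le n<h_v(m),\ v_n\equiv b\pmod m\}$. *)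

theory Defs
  imports "HOL-Number_Theory.Number_Theory"
begin

fun lucas_u :: "int \<Rightarrow> nat \<Rightarrow> int" where
  "lucas_u P 0 = 0"
| "lucas_u P (Suc 0) = 1"
| "lucas_u P (Suc (Suc n)) = P * lucas_u P (Suc n) + lucas_u P n"

fun lucas_v :: "int \<Rightarrow> nat \<Rightarrow> int" where
  "lucas_v P 0 = 2"
| "lucas_v P (Suc 0) = P"
| "lucas_v P (Suc (Suc n)) = P * lucas_v P (Suc n) + lucas_v P n"

text \<open>
  The period is required to hold from index 0 on. It exists for both sequences above and every
  positive modulus, since the recurrence can be run backwards over the integers.
\<close>
definition min_period :: "(nat \<Rightarrow> int) \<Rightarrow> nat \<Rightarrow> nat" where
  "min_period f m = (LEAST h. h > 0 \<and> (\<forall>n. [f (n + h) = f n] (mod int m)))"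

definition h_u :: "int \<Rightarrow> nat \<Rightarrow> nat" where
  "h_u P m = min_period (lucas_u P) m"

definition h_v :: "int \<Rightarrow> nat \<Rightarrow> nat" where
  "h_v P m = min_period (lucas_v P) m"

definition v_u :: "int \<Rightarrow> nat \<Rightarrow> int \<Rightarrow> nat" where
  "v_u P m b = card {n. n < h_u P m \<and> [lucas_u P n = b] (mod int m)}"

definition v_v :: "int \<Rightarrow> nat \<Rightarrow> int \<Rightarrow> nat" where
  "v_v P m b = card {n. n < h_v P m \<and> [lucas_v P n = b] (mod int m)}"

abbreviation cong_pm :: "int \<Rightarrow> int \<Rightarrow> int \<Rightarrow> bool" where
  "cong_pm b a m \<equiv> [b = a] (mod m) \<or> [b = - a] (mod m)"

end

theory Submission
  imports Defs
begin

text \<open>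
  Put \<open>D = P\<^sup>2 + 4\<close>. The identities \<open>u(n + 8m) - u(n) = u(4m) v(n + 4m)\<close> and
  \<open>v(n + 8m) - v(n) = D u(4m) u(n + 4m)\<close>, together with the fact that the 3-adic valuation of
  \<open>u(4m)\<close> is \<open>\<delta>\<close> plus that of \<open>m\<close>, give the period \<open>8 \<cdot> 3\<^sup>k\<^sup>-\<^sup>\<delta>\<close> modulo \<open>3\<^sup>k\<close>. They also show that along
  a residue class \<open>n \<equiv> r (mod 8)\<close> on which the companion factor is a unit, the sequence runs exactly
  once through the residues congruent modulo \<open>3\<^sup>\<delta>\<close> to its value at \<open>r\<close>.

  The companion factor of \<open>u\<close> is not a unit for \<open>r = 2, 6\<close>. There \<open>v(n)\<^sup>2 = D u(n)\<^sup>2 + 4\<close> turns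
  \<open>u(n) \<equiv> b\<close> into \<open>v(n)\<^sup>2 \<equiv> D b\<^sup>2 + 4\<close> plus a sign condition modulo 3, and \<open>v(n)\<close> runs exactly once
  through the multiples of \<open>3\<^sup>\<delta>\<close>, so one has to count the square roots of \<open>D b\<^sup>2 + 4\<close> modulo \<open>3\<^sup>k\<close> among
  these multiples. For \<open>v\<close> the exceptional classes are \<open>r = 0, 4\<close> and the congruence is
  \<open>D y\<^sup>2 \<equiv> b\<^sup>2 - 4\<close>.
\<close>

section \<open>Identities for Lucas sequences\<close>

text \<open>The factor \<open>lucas_u P (Suc s) - P * lucas_u P s\<close> is the term at index
  \<open>s - 1\<close>, written so that \<open>s = 0\<close> is covered as well.\<close>

lemma lucas_u_add:
  "lucas_u P (n + s) = lucas_u P (Suc n) * lucas_u P s + lucas_u P n * (lucas_u P (Suc s) - P * lucas_u P s)"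
  by (induction n rule: induct_nat_012) (simp_all add: algebra_simps)

lemma lucas_v_eq: "lucas_v P n = 2 * lucas_u P (Suc n) - P * lucas_u P n"
  by (induction n rule: induct_nat_012) (simp_all add: algebra_simps)

text \<open>One step of the recurrence replaces \<open>(X, Y)\<close> by
  \<open>(P X + Y, X)\<close>, which negates the quadratic form
  \<open>X^2 - P X Y - Y^2\<close>.\<close>

lemma lucas_u_cassini:
  "(lucas_u P (Suc n))\<^sup>2 - P * lucas_u P n * lucas_u P (Suc n) - (lucas_u P n)\<^sup>2 = (-1) ^ n"
  by (induction n) (simp_all add: algebra_simps power2_eq_square)

lemma lucas_v_square:
  "(lucas_v P n)\<^sup>2 = (P\<^sup>2 + 4) * (lucas_u P n)\<^sup>2 + 4 * (-1) ^ n"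
  using lucas_u_cassini[of P n] by (simp add: lucas_v_eq algebra_simps power2_eq_square)

lemma lucas_u_double: "lucas_u P (2 * n) = lucas_u P n * lucas_v P n"
  unfolding mult_2 lucas_u_add lucas_v_eq by (simp add: algebra_simps)

text \<open>In terms of the roots \<alpha>, \<beta> of \<open>x^2 = P x + 1\<close> both sides have
  the same expansion, because \<alpha>\<beta> = -1 and \<open>s\<close> is even. The identity turns
  a congruence between shifted terms into divisibility of a product.\<close>

lemma lucas_u_shift:
  assumes "even s"
  shows "lucas_u P (n + 2 * s) - lucas_u P n = lucas_u P s * lucas_v P (n + s)"
proof -
  have 1: "lucas_u P (Suc s) ^ 2 - P * lucas_u P s * lucas_u P (Suc s) - lucas_u P s ^ 2 = 1"
    using lucas_u_cassini[of P s] assms by simp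
  have 2: "lucas_u P (n + 2 * s) = lucas_u P (Suc (n + s)) * lucas_u P s
      + lucas_u P (n + s) * (lucas_u P (Suc s) - P * lucas_u P s)"
    unfolding mult_2 add.assoc[symmetric] by (rule lucas_u_add)
  have 3: "lucas_u P (Suc (n + s)) = lucas_u P (Suc n) * lucas_u P (Suc s) + lucas_u P n * lucas_u P s"
    using lucas_u_add[of P n "Suc s"] by (simp add: algebra_simps)
  \<comment> \<open>After expansion in the terms at \<open>n\<close>, \<open>n + 1\<close>,
    \<open>s\<close> and \<open>s + 1\<close>, the two sides differ by \<open>lucas_u P n\<close>
    times the Cassini identity at \<open>s\<close>.\<close>
  show ?thesis
    unfolding lucas_v_eq 2 3 lucas_u_add[of P n s]
    using arg_cong[OF 1, of "(*) (lucas_u P n)"] by (simp add: algebra_simps power2_eq_square)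
qed

text \<open>Combines the shift identity for u at \<open>n\<close> and \<open>n + 1\<close>, using
  \<open>2 v(n+1) - P v(n) = (P^2 + 4) u(n)\<close>.\<close>

lemma lucas_v_shift:
  assumes "even s"
  shows "lucas_v P (n + 2 * s) - lucas_v P n = (P\<^sup>2 + 4) * lucas_u P s * lucas_u P (n + s)"
proof -
  have 1: "lucas_v P (n + 2 * s) - lucas_v P n
    = 2 * (lucas_u P (Suc n + 2 * s) - lucas_u P (Suc n)) - P * (lucas_u P (n + 2 * s) - lucas_u P n)"
    by (simp add: lucas_v_eq algebra_simps)
  show ?thesis
    unfolding 1 lucas_u_shift[OF assms]
    by (simp add: lucas_v_eq algebra_simps power2_eq_square)
qed

text \<open>The shift identities at \<open>n = s\<close> for u and at \<open>n = 0\<close> for v,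
  combined. If 3 divides \<open>lucas_u P s\<close>, the second factor is divisible by 3 but not by
  9, so tripling the index adds exactly one factor 3.\<close>

lemma lucas_u_triple:
  assumes "even s"
  shows "lucas_u P (3 * s) = lucas_u P s * ((P\<^sup>2 + 4) * (lucas_u P s)\<^sup>2 + 3)"
proof -
  have "lucas_u P (3 * s) - lucas_u P s = lucas_u P s * lucas_v P (2 * s)"
    using lucas_u_shift[OF assms, of P s] by (simp add: mult_2[symmetric])
  moreover have "lucas_v P (2 * s) - 2 = (P\<^sup>2 + 4) * (lucas_u P s)\<^sup>2"
    using lucas_v_shift[OF assms, of P 0] by (simp add: power2_eq_square)
  ultimately show ?thesis by (simp add: algebra_simps)
qed

text \<open>The recurrence of the subsequences of step 2, with trace \<open>P^2 + 2\<close> and norm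
  1. Modulo a power of 3 dividing \<open>P^2 + 2\<close>, a shift by 4 is therefore a change of
  sign.\<close>

lemma lucas_u_add4: "lucas_u P (n + 4) = (P\<^sup>2 + 2) * lucas_u P (n + 2) - lucas_u P n"
proof -
  have 4: "n + 4 = Suc (Suc (Suc (Suc n)))" and 2: "n + 2 = Suc (Suc n)" by simp_all
  show ?thesis unfolding 4 2 by (simp add: algebra_simps power2_eq_square)
qed

lemma lucas_v_add4: "lucas_v P (n + 4) = (P\<^sup>2 + 2) * lucas_v P (n + 2) - lucas_v P n"
proof -
  have 4: "n + 4 = Suc (Suc (Suc (Suc n)))" and 2: "n + 2 = Suc (Suc n)" by simp_all
  show ?thesis unfolding 4 2 by (simp add: algebra_simps power2_eq_square)
qed

section \<open>Counting residues\<close>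

lemma cong_target: "[x = y] (mod m) \<Longrightarrow> [b = x] (mod m) \<longleftrightarrow> [b = y] (mod m)" for b x y m :: int
  by (meson cong_sym cong_trans)

lemma card_split_residues:
  fixes d N :: nat
  shows "card {n. n < d * N \<and> Q n} = (\<Sum>r<d. card {j. j < N \<and> Q (r + d * j)})"
proof -
  have "bij_betw (\<lambda>(r, j). r + d * j) (SIGMA r:{..<d}. {j. j < N \<and> Q (r + d * j)}) {n. n < d * N \<and> Q n}"
  proof (rule bij_betwI[where g = "\<lambda>n. (n mod d, n div d)"])
    show "(\<lambda>(r, j). r + d * j) \<in> (SIGMA r:{..<d}. {j. j < N \<and> Q (r + d * j)}) \<rightarrow> {n. n < d * N \<and> Q n}"
    proof clarsimp
      fix r j assume "r < d" "j < N"
      then have "r + d * j < d * Suc j" by simp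
      also have "\<dots> \<le> d * N" using \<open>j < N\<close> by (intro mult_le_mono2) simp
      finally show "r + d * j < d * N" .
    qed
    show "(\<lambda>n. (n mod d, n div d)) \<in> {n. n < d * N \<and> Q n} \<rightarrow> (SIGMA r:{..<d}. {j. j < N \<and> Q (r + d * j)})"
    proof clarsimp
      fix n assume "n < d * N"
      then show "n mod d < d \<and> n div d < N"
        by (cases "d = 0") (auto simp: less_mult_imp_div_less mult.commute)
    qed
  qed auto
  then have "card {n. n < d * N \<and> Q n} = card (SIGMA r:{..<d}. {j. j < N \<and> Q (r + d * j)})"
    by (rule bij_betw_same_card[symmetric])
  then show ?thesis by simp
qed

lemma card_residue_class:
  fixes c M N :: int
  assumes "M > 0" "N \<ge> 0"
  shows "card {x \<in> {0..<M * N}. [x = c] (mod M)} = nat N"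
proof -
  have "bij_betw (\<lambda>j. c mod M + M * j) {0..<N} {x \<in> {0..<M * N}. [x = c] (mod M)}"
  proof (rule bij_betwI[where g = "\<lambda>x. x div M"])
    show "(\<lambda>j. c mod M + M * j) \<in> {0..<N} \<rightarrow> {x \<in> {0..<M * N}. [x = c] (mod M)}"
    proof (clarsimp simp: cong_def assms, safe)
      fix j assume j: "0 \<le> j" "j < N"
      show "0 \<le> c mod M + M * j" using assms j by simp
      have "c mod M + M * j < M * (j + 1)" using assms by (simp add: algebra_simps)
      also have "\<dots> \<le> M * N" using assms j by (intro mult_left_mono) auto
      finally show "c mod M + M * j < M * N" .
    qed
    show "(\<lambda>x. x div M) \<in> {x \<in> {0..<M * N}. [x = c] (mod M)} \<rightarrow> {0..<N}"
    proof clarsimp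
      fix x assume x: "0 \<le> x" "x < M * N"
      then have "M * (x div M) < M * N"
        using minus_mod_eq_mult_div[of x M] \<open>M > 0\<close> by (smt (verit) pos_mod_sign)
      then show "0 \<le> x div M \<and> x div M < N"
        using x assms by (simp add: pos_imp_zdiv_nonneg_iff)
    qed
    show "c mod M + M * (x div M) = x" if "x \<in> {x \<in> {0..<M * N}. [x = c] (mod M)}" for x
      using that mult_div_mod_eq[of M x] by (auto simp: cong_def)
  qed (use assms in simp)
  then have "card {x \<in> {0..<M * N}. [x = c] (mod M)} = card {0..<N}"
    by (rule bij_betw_same_card[symmetric])
  then show ?thesis by simp
qed

text \<open>Injectivity suffices: both sides of the induced map have \<open>m ^ (k - d)\<close> elements.\<close>
lemma card_transport:
  fixes f :: "nat \<Rightarrow> int" and m c :: int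
  assumes "d \<le> k" "m > 0"
    and inj: "\<And>i j. i < nat (m ^ (k - d)) \<Longrightarrow> j < nat (m ^ (k - d)) \<Longrightarrow> [f i = f j] (mod m ^ k) \<Longrightarrow> i = j"
    and img: "\<And>i. [f i = c] (mod m ^ d)"
    and Q: "\<And>x y. [x = y] (mod m ^ k) \<Longrightarrow> Q x \<longleftrightarrow> Q y"
  shows "card {j. j < nat (m ^ (k - d)) \<and> Q (f j)} = card {y \<in> {0..<m ^ k}. [y = c] (mod m ^ d) \<and> Q y}"
proof -
  let ?N = "nat (m ^ (k - d))" and ?g = "\<lambda>j. f j mod m ^ k"
  let ?Y = "{y \<in> {0..<m ^ k}. [y = c] (mod m ^ d)}"
  have mk: "m ^ k = m ^ d * m ^ (k - d)" using \<open>d \<le> k\<close> by (simp flip: power_add)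
  have inj': "inj_on ?g {..<?N}"
    by (rule inj_onI) (use inj in \<open>auto simp: cong_def\<close>)
  have sub: "?g ` {..<?N} \<subseteq> ?Y"
  proof (rule image_subsetI)
    fix i
    have "[?g i = f i] (mod m ^ d)"
      by (rule cong_dvd_modulus[of _ _ "m ^ k"]) (use \<open>d \<le> k\<close> in \<open>auto simp: le_imp_power_dvd\<close>)
    with img[of i] show "?g i \<in> {y \<in> {0..<m ^ k}. [y = c] (mod m ^ d)}"
      using \<open>m > 0\<close> by (auto intro: cong_trans)
  qed
  have "card ?Y = ?N"
    unfolding mk by (rule card_residue_class) (use \<open>m > 0\<close> in auto)
  then have "?g ` {..<?N} = ?Y"
    using sub inj' by (intro card_subset_eq finite_subset[of ?Y "{0..<m ^ k}"]) (auto simp: card_image)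
  then have "bij_betw ?g {..<?N} ?Y" using inj' by (simp add: bij_betw_def)
  moreover have "Q (?g j) \<longleftrightarrow> Q (f j)" for j by (rule Q) simp
  ultimately have "bij_betw ?g {j \<in> {..<?N}. Q (f j)} {y \<in> ?Y. Q y}"
    by (intro bij_betw_Collect) auto
  then have "card {j \<in> {..<?N}. Q (f j)} = card {y \<in> ?Y. Q y}"
    by (rule bij_betw_same_card)
  then show ?thesis by (simp add: conj_assoc)
qed

text \<open>Reduces the injectivity demanded by \<open>card_transport\<close> to a statement about
  one forward shift: two indices below \<open>N\<close> differ by a multiple of \<open>N\<close>
  only if they are equal.\<close>

lemma index_eq_if_cong:
  fixes f :: "nat \<Rightarrow> int" and i j N :: nat
  assumes "\<And>i m. [f (i + m) = f i] (mod M) \<Longrightarrow> N dvd m"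
    and "i < N" "j < N" "[f i = f j] (mod M)"
  shows "i = j"
  using assms(2-)
proof (induction i j rule: linorder_wlog)
  case (le i j)
  then have "[f (i + (j - i)) = f i] (mod M)" using cong_sym by fastforce
  then have "N dvd j - i" by (rule assms(1))
  then show ?case using le dvd_imp_le[of N "j - i"] by linarith
next
  case (sym i j)
  then show ?case using cong_sym by metis
qed

text \<open>Only \<open>b mod 3 ^ k\<close> can qualify, and as \<open>d \<le> k\<close> it lies in
  the same class modulo \<open>3 ^ d\<close> as \<open>b\<close>.\<close>

lemma card_cong_both:
  fixes b c :: int
  assumes "d \<le> k"
  shows "card {y \<in> {0..<3 ^ k}. [y = c] (mod 3 ^ d) \<and> [y = b] (mod 3 ^ k)}
    = (if [b = c] (mod 3 ^ d) then 1 else 0)"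
proof -
  have eq: "y \<in> {0..<3 ^ k} \<and> [y = b] (mod 3 ^ k) \<longleftrightarrow> y = b mod 3 ^ k" for y
    using mod_pos_pos_trivial[of y "3 ^ k"] pos_mod_bound[of "3 ^ k" b] pos_mod_sign[of "3 ^ k" b]
    unfolding cong_def by fastforce
  have "[b mod 3 ^ k = b] (mod 3 ^ d)"
    by (rule cong_dvd_modulus[of _ _ "3 ^ k"]) (use assms in \<open>auto simp: le_imp_power_dvd\<close>)
  then have "[b mod 3 ^ k = c] (mod 3 ^ d) \<longleftrightarrow> [b = c] (mod 3 ^ d)"
    using cong_trans cong_sym by blast
  moreover have "{y \<in> {0..<3 ^ k}. [y = c] (mod 3 ^ d) \<and> [y = b] (mod 3 ^ k)}
    = {y. y = b mod 3 ^ k \<and> [b mod 3 ^ k = c] (mod 3 ^ d)}"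
  proof (rule Collect_cong)
    show "y \<in> {0..<3 ^ k} \<and> [y = c] (mod 3 ^ d) \<and> [y = b] (mod 3 ^ k) \<longleftrightarrow>
      y = b mod 3 ^ k \<and> [b mod 3 ^ k = c] (mod 3 ^ d)" for y
      using eq[of y] by metis
  qed
  ultimately show ?thesis by simp
qed

section \<open>Quadratic congruences modulo powers of 3\<close>

lemma nat_3_power: "nat (3 ^ n) = 3 ^ n"
  by (simp add: nat_power_eq)

lemma power_dvd_square_iff:
  fixes p y :: int
  assumes "prime p"
  shows "p ^ k dvd y\<^sup>2 \<longleftrightarrow> p ^ ((k + 1) div 2) dvd y"
proof (cases "y = 0")
  case False
  have "p ^ k dvd y\<^sup>2 \<longleftrightarrow> k \<le> 2 * multiplicity p y"
    using assms False
    by (subst power_dvd_iff_le_multiplicity) (auto simp: prime_elem_multiplicity_power_distrib)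
  also have "\<dots> \<longleftrightarrow> (k + 1) div 2 \<le> multiplicity p y" by linarith
  also have "\<dots> \<longleftrightarrow> p ^ ((k + 1) div 2) dvd y"
    using assms False by (subst power_dvd_iff_le_multiplicity) auto
  finally show ?thesis .
qed simp

lemma prime_3_int: "prime (3::int)"
  using prime_nat_int_transfer[of 3] by simp

lemma coprime_3_power:
  assumes "\<not> 3 dvd (x::int)"
  shows "coprime (3 ^ j) x"
  using prime_imp_coprime[OF prime_3_int assms] by simp

lemma power_3_dvd_mult_cancel:
  assumes "\<not> 3 dvd (x::int)"
  shows "3 ^ j dvd y * x \<longleftrightarrow> 3 ^ j dvd y" "3 ^ j dvd x * y \<longleftrightarrow> 3 ^ j dvd y"
  using coprime_3_power[OF assms, of j]
  by (simp_all only: coprime_dvd_mult_left_iff coprime_dvd_mult_right_iff)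

lemma square_mod_3: "\<not> 3 dvd (x::int) \<Longrightarrow> [x\<^sup>2 = 1] (mod 3)"
proof -
  assume "\<not> 3 dvd x"
  then have "x mod 3 = 1 \<or> x mod 3 = 2" by presburger
  then show ?thesis
    unfolding cong_def by (subst power_mod[symmetric]) auto
qed

text \<open>The factors \<open>b - t\<close> and \<open>b + t\<close> of the difference of squares
  are not both divisible by 3, since they differ by \<open>2 t\<close>. Hence one of them absorbs
  the whole power of 3.\<close>

lemma cong_pm_iff_squares:
  fixes b t :: int
  assumes "\<not> 3 dvd t"
  shows "cong_pm b t (3 ^ j) \<longleftrightarrow> [b\<^sup>2 = t\<^sup>2] (mod 3 ^ j)"
proof
  assume "[b\<^sup>2 = t\<^sup>2] (mod 3 ^ j)"
  then have d: "3 ^ j dvd (b - t) * (b + t)"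
    by (simp add: cong_iff_dvd_diff power2_eq_square algebra_simps)
  have "\<not> (3 dvd b - t \<and> 3 dvd b + t)"
  proof
    assume "3 dvd b - t \<and> 3 dvd b + t"
    with assms show False by presburger
  qed
  then consider "\<not> 3 dvd b - t" | "\<not> 3 dvd b + t" by blast
  then show "cong_pm b t (3 ^ j)"
  proof cases
    case 1
    then show ?thesis using d coprime_3_power[OF 1, of j]
      by (simp add: cong_iff_dvd_diff coprime_dvd_mult_right_iff)
  next
    case 2
    then show ?thesis using d coprime_3_power[OF 2, of j]
      by (simp add: cong_iff_dvd_diff coprime_dvd_mult_left_iff)
  qed
next
  assume "cong_pm b t (3 ^ j)"
  then show "[b\<^sup>2 = t\<^sup>2] (mod 3 ^ j)"
    using cong_pow[of b t "3 ^ j" 2] cong_pow[of b "- t" "3 ^ j" 2] by auto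
qed

text \<open>Hensel lifting: the derivative \<open>2 C s\<close> is a unit modulo 3, so a root modulo
  \<open>3 ^ n\<close> can be corrected to one modulo the next power.\<close>

lemma exists_sqrt_mod_power_3:
  fixes C a :: int
  assumes "\<not> 3 dvd C" "[a = C] (mod 3)"
  shows "\<exists>s. \<not> 3 dvd s \<and> [C * s\<^sup>2 = a] (mod 3 ^ n)"
proof (induction n)
  case 0
  show ?case by (rule exI[of _ 1]) simp
next
  case (Suc n)
  show ?case
  \<comment> \<open>The lifting step needs \<open>2 n \<ge> n + 1\<close> to discard the quadratic
    term; the modulus 3 itself is served by the root 1.\<close>
  proof (cases "n = 0")
    case True
    then show ?thesis using assms(2) by (intro exI[of _ 1]) (simp add: cong_sym)
  next
    case False
    obtain s where s: "\<not> 3 dvd s" "[C * s\<^sup>2 = a] (mod 3 ^ n)" using Suc by blast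
    then obtain q where "C * s\<^sup>2 - a = 3 ^ n * q"
      unfolding cong_iff_dvd_diff by (elim dvdE)
    then have q: "C * s\<^sup>2 = a + 3 ^ n * q" by simp
    have "[(C * s)\<^sup>2 = 1] (mod 3)"
      using square_mod_3[of "C * s"] assms s prime_dvd_mult_iff[OF prime_3_int] by blast
    then have "3 dvd 1 + 2 * (C * s)\<^sup>2" unfolding cong_iff_dvd_diff by presburger
    then obtain r where r: "1 + 2 * (C * s)\<^sup>2 = 3 * r" by (elim dvdE)
    obtain n' where n': "n = Suc n'" using False by (cases n) auto
    \<comment> \<open>The Newton correction is \<open>- q / (2 C s)\<close>; modulo 3 one has
      \<open>- 1 / 2 = 1\<close>, and \<open>C s\<close> is its own inverse.\<close>
    define t where "t = q * C * s"
    have "C * (s + 3 ^ n * t)\<^sup>2 = C * s\<^sup>2 + 3 ^ n * (2 * C * s * t) + C * t\<^sup>2 * 3 ^ n * 3 ^ n"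
      by (simp add: power2_eq_square algebra_simps)
    also have "\<dots> = a + 3 ^ n * q * (1 + 2 * (C * s)\<^sup>2) + C * t\<^sup>2 * 3 ^ n * 3 ^ n"
      unfolding q t_def by (simp add: power2_eq_square algebra_simps)
    also have "\<dots> = a + 3 ^ Suc n * (q * r + C * t\<^sup>2 * 3 ^ n')"
      unfolding r by (simp add: n' algebra_simps)
    finally have "[C * (s + 3 ^ n * t)\<^sup>2 = a] (mod 3 ^ Suc n)"
      by (simp add: cong_iff_dvd_diff)
    moreover have "\<not> 3 dvd s + 3 ^ n * t"
      using s(1) n' by (simp add: dvd_add_left_iff)
    ultimately show ?thesis by blast
  qed
qed

text \<open>The restriction to multiples of \<open>3 ^ d\<close> reflects the values the companion
  sequence takes at the critical indices. The coefficient \<open>C\<close> will be 1 when counting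
  for u and \<open>P^2 + 4\<close> when counting for v.\<close>

definition square_sols :: "int \<Rightarrow> int \<Rightarrow> nat \<Rightarrow> nat \<Rightarrow> int set" where
  "square_sols C A d k = {y \<in> {0..<3 ^ k}. 3 ^ d dvd y \<and> [C * y\<^sup>2 = A] (mod 3 ^ k)}"

text \<open>Both conditions on \<open>y\<close> are lower bounds for its 3-adic valuation, namely
  \<open>d\<close> and half of \<open>k\<close> rounded up, so only the larger one counts.\<close>

lemma card_square_sols_0:
  assumes "\<not> 3 dvd C" "[A = 0] (mod 3 ^ k)" "d \<le> k"
  shows "card (square_sols C A d k) = 3 ^ (k - max d ((k + 1) div 2))"
proof -
  let ?m = "max d ((k + 1) div 2)"
  have mk: "?m \<le> k" using assms(3) by auto
  have "3 ^ d dvd y \<and> [C * y\<^sup>2 = A] (mod 3 ^ k) \<longleftrightarrow> [y = 0] (mod 3 ^ ?m)" for y :: int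
  proof -
    have "[C * y\<^sup>2 = A] (mod 3 ^ k) \<longleftrightarrow> [C * y\<^sup>2 = 0] (mod 3 ^ k)"
      using assms(2) cong_trans cong_sym by blast
    also have "\<dots> \<longleftrightarrow> 3 ^ ((k + 1) div 2) dvd y"
      using coprime_3_power[OF assms(1), of k]
      by (simp add: cong_0_iff coprime_dvd_mult_right_iff power_dvd_square_iff[OF prime_3_int])
    finally show ?thesis
      by (auto simp: max_def cong_0_iff intro: power_le_dvd)
  qed
  then have "square_sols C A d k = {y \<in> {0..<3 ^ ?m * 3 ^ (k - ?m)}. [y = 0] (mod 3 ^ ?m)}"
    unfolding square_sols_def using mk by (simp flip: power_add)
  then have "card (square_sols C A d k) = nat (3 ^ (k - ?m))"
    by (simp only:) (rule card_residue_class, auto)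
  then show ?thesis by (simp add: nat_power_eq)
qed

text \<open>Here \<open>A = 3^(2l) a\<close> with \<open>a\<close> congruent to \<open>C\<close>
  modulo 3, so the solutions are \<open>y = 3^l s\<close> with \<open>C s^2\<close> congruent to
  \<open>a\<close> modulo \<open>3^(k - 2l)\<close>. There are two classes of \<open>s\<close>,
  hence two classes of \<open>y\<close> modulo \<open>3^(k - l)\<close>, each with
  \<open>3^l\<close> representatives modulo \<open>3^k\<close>.\<close>

lemma card_square_sols_unit:
  assumes "\<not> 3 dvd C" "d \<le> l" "2 * l + 1 \<le> k" "[A = C * 3 ^ (2 * l)] (mod 3 ^ (2 * l + 1))"
  shows "card (square_sols C A d k) = 2 * 3 ^ l"
proof -
  \<comment> \<open>\<open>N\<close> is the precision left after dividing the congruence by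
    \<open>3 ^ (2 * l)\<close>.\<close>
  define N where "N = k - 2 * l"
  have k: "k = 2 * l + N" and kl: "k - l = l + N" and N: "N \<ge> 1" using assms(3) by (auto simp: N_def)
  obtain q where "A - C * 3 ^ (2 * l) = 3 ^ (2 * l + 1) * q"
    using assms(4) unfolding cong_iff_dvd_diff by (elim dvdE)
  then have q: "A = C * 3 ^ (2 * l) + 3 ^ (2 * l + 1) * q" by simp
  define a where "a = C + 3 * q"
  have A: "A = 3 ^ (2 * l) * a" by (simp add: q a_def algebra_simps)
  have "[a = C] (mod 3)" by (simp add: a_def cong_iff_dvd_diff)
  then obtain s\<^sub>0 where s0: "\<not> 3 dvd s\<^sub>0" "[C * s\<^sub>0\<^sup>2 = a] (mod 3 ^ N)"
    using exists_sqrt_mod_power_3[OF assms(1)] by blast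
  have iff: "[C * (3 ^ l * s)\<^sup>2 = A] (mod 3 ^ k) \<longleftrightarrow> cong_pm (3 ^ l * s) (3 ^ l * s\<^sub>0) (3 ^ (l + N))" for s
  proof -
    have "C * (3 ^ l * s)\<^sup>2 - A = 3 ^ (2 * l) * (C * s\<^sup>2 - a)"
      by (simp add: A algebra_simps power_mult_distrib power_mult[symmetric])
    then have "[C * (3 ^ l * s)\<^sup>2 = A] (mod 3 ^ k) \<longleftrightarrow> [C * s\<^sup>2 = a] (mod 3 ^ N)"
      by (simp add: cong_iff_dvd_diff k power_add)
    also have "\<dots> \<longleftrightarrow> [C * s\<^sup>2 = C * s\<^sub>0\<^sup>2] (mod 3 ^ N)"
      using s0(2) cong_trans cong_sym by blast
    also have "\<dots> \<longleftrightarrow> [s\<^sup>2 = s\<^sub>0\<^sup>2] (mod 3 ^ N)"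
      using coprime_3_power[OF assms(1), of N] by (intro cong_mult_lcancel) (simp add: coprime_commute)
    also have "\<dots> \<longleftrightarrow> cong_pm s s\<^sub>0 (3 ^ N)"
      using cong_pm_iff_squares[OF s0(1)] by blast
    also have "\<dots> \<longleftrightarrow> cong_pm (3 ^ l * s) (3 ^ l * s\<^sub>0) (3 ^ (l + N))"
      by (simp add: cong_iff_dvd_diff power_add flip: right_diff_distrib distrib_left)
    finally show ?thesis .
  qed
  \<comment> \<open>Every solution is divisible by \<open>3 ^ l\<close>, and the condition on
    \<open>3 ^ d\<close> is then implied by \<open>d \<le> l\<close>.\<close>
  have mem: "3 ^ d dvd y \<and> [C * y\<^sup>2 = A] (mod 3 ^ k) \<longleftrightarrow> cong_pm y (3 ^ l * s\<^sub>0) (3 ^ (l + N))" for y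
  proof (cases "3 ^ l dvd y")
    case True
    moreover have "(3::int) ^ d dvd 3 ^ l" using assms(2) by (rule le_imp_power_dvd)
    ultimately show ?thesis using iff by (auto intro: dvd_trans)
  next
    case False
    have "\<not> [C * y\<^sup>2 = A] (mod 3 ^ k)"
    proof
      assume "[C * y\<^sup>2 = A] (mod 3 ^ k)"
      then have "[C * y\<^sup>2 = A] (mod 3 ^ (2 * l))"
        by (rule cong_dvd_modulus) (simp add: k power_add)
      then have "3 ^ (2 * l) dvd C * y\<^sup>2" by (simp add: A cong_dvd_iff)
      then have "3 ^ (2 * l) dvd y\<^sup>2"
        using coprime_3_power[OF assms(1)] by (simp add: coprime_dvd_mult_right_iff)
      then show False using False by (simp add: power_dvd_square_iff[OF prime_3_int])
    qed
    moreover have "\<not> cong_pm y (3 ^ l * s\<^sub>0) (3 ^ (l + N))"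
    proof
      assume "cong_pm y (3 ^ l * s\<^sub>0) (3 ^ (l + N))"
      then have "cong_pm y (3 ^ l * s\<^sub>0) (3 ^ l)"
        by (auto intro: cong_dvd_modulus simp: power_add)
      then show False using False by (auto simp: cong_dvd_iff)
    qed
    ultimately show ?thesis by blast
  qed
  let ?R = "\<lambda>c. {y \<in> {0..<3 ^ (l + N) * 3 ^ l}. [y = c] (mod 3 ^ (l + N) :: int)}"
  have "square_sols C A d k = ?R (3 ^ l * s\<^sub>0) \<union> ?R (- (3 ^ l * s\<^sub>0))"
  proof -
    have "(3::int) ^ k = 3 ^ (l + N) * 3 ^ l" by (simp add: k flip: power_add)
    then show ?thesis unfolding square_sols_def mem by auto
  qed
  moreover have "?R (3 ^ l * s\<^sub>0) \<inter> ?R (- (3 ^ l * s\<^sub>0)) = {}"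
  proof -
    have "\<not> [3 ^ l * s\<^sub>0 = - (3 ^ l * s\<^sub>0)] (mod 3 ^ (l + N))"
    proof
      assume "[3 ^ l * s\<^sub>0 = - (3 ^ l * s\<^sub>0)] (mod 3 ^ (l + N))"
      then have "3 ^ l * 3 ^ N dvd 3 ^ l * (2 * s\<^sub>0)"
        by (simp add: cong_iff_dvd_diff power_add)
      then have "3 ^ N dvd 2 * s\<^sub>0" by simp
      then have "3 dvd 2 * s\<^sub>0" using N by (metis dvd_power dvd_trans less_le_trans zero_less_one)
      then show False using s0(1) by presburger
    qed
    then show ?thesis by (auto dest: cong_trans cong_sym)
  qed
  moreover have "card (?R c) = 3 ^ l" for c
    using card_residue_class[of "3 ^ (l + N)" "3 ^ l" c] by (simp add: nat_power_eq)
  moreover have "finite (?R c)" for c by (rule finite_subset[OF Collect_restrict]) simp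
  ultimately show ?thesis by (simp add: card_Un_disjoint)
qed

text \<open>Any solution \<open>y\<close> betrays the shape of \<open>A\<close>: with
  \<open>l\<close> the valuation of \<open>y\<close>, either \<open>y^2\<close> vanishes modulo
  \<open>3^k\<close>, or its unit part is a square and hence 1 modulo 3. So the two counting lemmas
  above cover every solvable case. The bound \<open>2 * l < k\<close> is recorded because truncated
  subtraction would admit \<open>l = 0\<close> when \<open>k = 0\<close>.\<close>

lemma square_sols_nonempty:
  assumes "y \<in> square_sols C A d k"
  shows "[A = 0] (mod 3 ^ k) \<or>
    (\<exists>l\<in>{d..(k - 1) div 2}. 2 * l < k \<and> [A = C * 3 ^ (2 * l)] (mod 3 ^ (2 * l + 1)))"
proof (cases "[A = 0] (mod 3 ^ k)")
  case False
  have y: "3 ^ d dvd y" "[A = C * y\<^sup>2] (mod 3 ^ k)"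
    using assms by (auto simp: square_sols_def cong_sym)
  with False have nz: "\<not> 3 ^ k dvd y\<^sup>2"
    by (metis cong_0_iff cong_trans dvd_mult)
  then have "y \<noteq> 0" by auto
  define l where "l = multiplicity 3 y"
  obtain t where t: "y = 3 ^ l * t" "\<not> 3 dvd t"
    using multiplicity_decompose'[of y 3] \<open>y \<noteq> 0\<close> prime_3_int unfolding l_def by auto
  have dl: "d \<le> l" using y(1) \<open>y \<noteq> 0\<close> unfolding l_def
    by (subst (asm) power_dvd_iff_le_multiplicity) auto
  have lk: "2 * l < k"
  proof (rule ccontr)
    assume "\<not> 2 * l < k"
    then have "3 ^ k dvd (3::int) ^ (2 * l)" by (intro le_imp_power_dvd) simp
    then have "3 ^ k dvd y\<^sup>2" by (simp add: t power_mult_distrib power_mult[symmetric] mult.commute)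
    with nz show False by simp
  qed
  have "[A = C * y\<^sup>2] (mod 3 ^ (2 * l + 1))"
    using y(2) by (rule cong_dvd_modulus) (use lk in \<open>intro le_imp_power_dvd, simp\<close>)
  moreover have "[C * y\<^sup>2 = C * 3 ^ (2 * l)] (mod 3 ^ (2 * l + 1))"
  proof -
    have "C * y\<^sup>2 - C * 3 ^ (2 * l) = 3 ^ (2 * l) * (C * (t\<^sup>2 - 1))"
      by (simp add: t algebra_simps power_mult_distrib power_mult[symmetric])
    moreover have "3 dvd t\<^sup>2 - 1" using square_mod_3[OF t(2)] by (simp add: cong_iff_dvd_diff)
    ultimately show ?thesis by (simp add: cong_iff_dvd_diff)
  qed
  ultimately have "[A = C * 3 ^ (2 * l)] (mod 3 ^ (2 * l + 1))" by (rule cong_trans)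
  moreover have "l \<in> {d..(k - 1) div 2}" using dl lk by auto
  ultimately show ?thesis using lk by blast
qed simp

lemma square_cong_exact_power:
  fixes x :: int
  assumes "3 ^ l dvd x" "\<not> 3 ^ (l + 1) dvd x"
  shows "[x\<^sup>2 = 3 ^ (2 * l)] (mod 3 ^ (2 * l + 1))"
proof -
  obtain t where t: "x = 3 ^ l * t" using assms(1) by (elim dvdE)
  have "\<not> 3 dvd t" using assms(2) by (auto simp: t)
  then have "3 dvd t\<^sup>2 - 1" using square_mod_3 by (simp add: cong_iff_dvd_diff)
  moreover have "x\<^sup>2 - 3 ^ (2 * l) = 3 ^ (2 * l) * (t\<^sup>2 - 1)"
    by (simp add: t algebra_simps power_mult_distrib power_mult[symmetric])
  ultimately show ?thesis by (simp add: cong_iff_dvd_diff)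
qed

lemma cong_multiple_iff:
  fixes c y M :: int
  assumes "M dvd c"
  shows "[y = c] (mod M) \<longleftrightarrow> M dvd y"
  using assms by (meson cong_dvd_iff cong_iff_dvd_diff dvd_diff)

lemma cong_scaled_square:
  fixes x y :: int
  assumes "[x = y] (mod M)"
  shows "[C * x\<^sup>2 = A] (mod M) \<longleftrightarrow> [C * y\<^sup>2 = A] (mod M)"
proof -
  have "[C * x\<^sup>2 = C * y\<^sup>2] (mod M)" by (intro cong_scalar_left cong_pow assms)
  then show ?thesis by (meson cong_sym cong_trans)
qed

lemma square_cong_0:
  fixes x :: int
  assumes "3 ^ l dvd x" "k \<le> 2 * l"
  shows "[x\<^sup>2 = 0] (mod 3 ^ k)"
proof -
  have "3 ^ (2 * l) dvd x\<^sup>2" using dvd_power_same[OF assms(1), of 2] by (simp add: power_mult[symmetric] mult.commute)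
  then show ?thesis using assms(2) by (simp add: cong_0_iff power_le_dvd)
qed

lemma card_square_sols_0_large:
  assumes "\<not> 3 dvd C" "[A = 0] (mod 3 ^ k)" "d \<le> k" "2 * d - 1 \<le> k"
  shows "card (square_sols C A d k) = 3 ^ (k div 2)"
proof -
  have "k - max d ((k + 1) div 2) = k div 2" using assms(4) by linarith
  then show ?thesis using card_square_sols_0[OF assms(1-3)] by simp
qed

lemma card_square_sols_0_small:
  assumes "\<not> 3 dvd C" "[A = 0] (mod 3 ^ k)" "d \<le> k" "k < 2 * d - 1"
  shows "card (square_sols C A d k) = 3 ^ (k - d)"
proof -
  have "max d ((k + 1) div 2) = d" using assms(4) by linarith
  then show ?thesis using card_square_sols_0[OF assms(1-3)] by simp
qed

lemma square_sols_empty: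
  assumes "\<not> [A = 0] (mod 3 ^ k)"
    and "\<And>l. l \<in> {d..(k - 1) div 2} \<Longrightarrow> 2 * l < k \<Longrightarrow> \<not> [A = C * 3 ^ (2 * l)] (mod 3 ^ (2 * l + 1))"
  shows "square_sols C A d k = {}"
  using square_sols_nonempty assms by blast

lemma power_dvd_if_cong_0:
  assumes "[A = 0] (mod 3 ^ k)" "d \<le> k"
  shows "3 ^ d dvd (A::int)"
  using assms by (auto simp: cong_0_iff intro: power_le_dvd)

lemma power_dvd_if_cong_unit:
  assumes "[A = C * 3 ^ (2 * l)] (mod 3 ^ (2 * l + 1))" "d \<le> l"
  shows "3 ^ d dvd (A::int)"
proof -
  have "[A = C * 3 ^ (2 * l)] (mod 3 ^ d)"
    using assms(1) by (rule cong_dvd_modulus) (use assms(2) in \<open>intro le_imp_power_dvd, simp\<close>)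
  moreover have "3 ^ d dvd C * 3 ^ (2 * l)"
    using assms(2) by (intro dvd_mult le_imp_power_dvd) simp
  ultimately show ?thesis by (simp add: cong_multiple_iff)
qed

text \<open>Each of the two solvable shapes of \<open>A\<close> forces \<open>3 ^ d\<close> to
  divide \<open>A\<close>.\<close>

lemma square_sols_empty_if_not_dvd:
  assumes "\<not> 3 ^ d dvd A" "d \<le> k"
  shows "square_sols C A d k = {}"
proof (rule square_sols_empty)
  show "\<not> [A = 0] (mod 3 ^ k)" using assms power_dvd_if_cong_0 by blast
  show "\<not> [A = C * 3 ^ (2 * l)] (mod 3 ^ (2 * l + 1))" if "l \<in> {d..(k - 1) div 2}" for l
    using assms(1) that power_dvd_if_cong_unit[of A C l d] by auto
qed

lemma even_if_cong_minus_one_power: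
  assumes "[(- 1) ^ i * x = x] (mod 3)" "\<not> 3 dvd (x::int)"
  shows "even i"
proof (rule ccontr)
  assume "odd i"
  then have "3 dvd - x - x" using assms(1) by (simp add: cong_iff_dvd_diff)
  with assms(2) show False by presburger
qed

text \<open>Two opposite critical classes share one solution count \<open>S\<close>. The sign of
  \<open>b\<close> modulo 3 decides which of them receives it, and for \<open>3 dvd b\<close> there
  is nothing to distribute.\<close>

lemma cong_pm_split_3:
  fixes b e :: int and S :: nat
  assumes "\<not> 3 dvd e" "3 dvd b \<Longrightarrow> S = 0"
  shows "(if [b = e] (mod 3) then S else 0) + (if [b = - e] (mod 3) then S else 0) = S"
proof -
  have "\<not> ([b = e] (mod 3) \<and> [b = - e] (mod 3))" "3 dvd b \<or> [b = e] (mod 3) \<or> [b = - e] (mod 3)"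
    using assms(1) unfolding cong_iff_dvd_diff by - presburger+
  then show ?thesis using assms(2) by auto
qed

text \<open>Squaring loses only the sign of a unit, and the residue modulo 3 recovers it.\<close>

lemma cong_iff_cong_3_and_squares:
  fixes b t c :: int
  assumes "\<not> 3 dvd t" "k \<ge> 1" "[t = c] (mod 3)"
  shows "[t = b] (mod 3 ^ k) \<longleftrightarrow> [b = c] (mod 3) \<and> [b\<^sup>2 = t\<^sup>2] (mod 3 ^ k)"
proof -
  have 3: "[x = y] (mod 3 ^ k) \<Longrightarrow> [x = y] (mod 3)" for x y :: int
    using assms(2) by (elim cong_dvd_modulus) auto
  have "\<not> ([b = c] (mod 3) \<and> [b = - t] (mod 3 ^ k))"
  proof
    assume "[b = c] (mod 3) \<and> [b = - t] (mod 3 ^ k)"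
    then have "3 dvd b - c" "3 dvd b - (- t)" "3 dvd t - c"
      using 3[of b "- t"] assms(3) unfolding cong_iff_dvd_diff by blast+
    with assms(1) show False by presburger
  qed
  moreover have "[b = t] (mod 3 ^ k) \<Longrightarrow> [b = c] (mod 3)"
    using 3 assms(3) cong_trans by blast
  ultimately show ?thesis
    unfolding cong_pm_iff_squares[OF assms(1), symmetric] cong_sym_eq[of t b] by blast
qed

section \<open>Valuations and periods\<close>

locale lucas_3 =
  fixes P :: int and \<delta> :: nat
  assumes not_3_dvd_P: "\<not> 3 dvd P"
    and \<delta>_pos: "\<delta> \<ge> 1"
    and power_dvd: "3 ^ \<delta> dvd P\<^sup>2 + 2"
    and not_power_dvd: "\<not> 3 ^ (\<delta> + 1) dvd P\<^sup>2 + 2"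
begin

abbreviation "u \<equiv> lucas_u P"
abbreviation "v \<equiv> lucas_v P"
abbreviation "D \<equiv> P\<^sup>2 + 4"

section \<open>Residues modulo \<open>3 ^ \<delta>\<close> and 3-adic valuations of terms\<close>

lemma P_square: "[P\<^sup>2 = 1] (mod 3)"
  using square_mod_3[OF not_3_dvd_P] .

lemma not_3_dvd_D: "\<not> 3 dvd D"
  using P_square unfolding cong_iff_dvd_diff by presburger

lemma cong_3: "[x = y] (mod 3 ^ \<delta>) \<Longrightarrow> [x = y] (mod 3)" for x y :: int
  using \<delta>_pos by (elim cong_dvd_modulus) auto

lemma u_add4: "[u (n + 4) = - u n] (mod 3 ^ \<delta>)"
  unfolding lucas_u_add4 cong_iff_dvd_diff using power_dvd by simp

lemma v_add4: "[v (n + 4) = - v n] (mod 3 ^ \<delta>)"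
  unfolding lucas_v_add4 cong_iff_dvd_diff using power_dvd by simp

lemma u_add_4mult: "[u (n + 4 * i) = (- 1) ^ i * u n] (mod 3 ^ \<delta>)"
proof (induction i)
  case (Suc i)
  have "[u (n + 4 * i + 4) = - u (n + 4 * i)] (mod 3 ^ \<delta>)" by (rule u_add4)
  also have "[- u (n + 4 * i) = - ((- 1) ^ i * u n)] (mod 3 ^ \<delta>)"
    using Suc by (simp add: cong_minus_minus_iff)
  finally show ?case by (simp add: algebra_simps)
qed simp

lemma v_add_4mult: "[v (n + 4 * i) = (- 1) ^ i * v n] (mod 3 ^ \<delta>)"
proof (induction i)
  case (Suc i)
  have "[v (n + 4 * i + 4) = - v (n + 4 * i)] (mod 3 ^ \<delta>)" by (rule v_add4)
  also have "[- v (n + 4 * i) = - ((- 1) ^ i * v n)] (mod 3 ^ \<delta>)"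
    using Suc by (simp add: cong_minus_minus_iff)
  finally show ?case by (simp add: algebra_simps)
qed simp

lemma u_add_8mult: "[u (n + 8 * i) = u n] (mod 3 ^ \<delta>)"
  using u_add_4mult[of n "2 * i"] by simp

lemma v_add_8mult: "[v (n + 8 * i) = v n] (mod 3 ^ \<delta>)"
  using v_add_4mult[of n "2 * i"] by simp

lemma dvd_P_square: "3 dvd P * P + 2"
  using P_square unfolding cong_iff_dvd_diff power2_eq_square by presburger

lemma u_2: "u 2 = P" and u_3: "u 3 = P * P + 1" and v_2: "v 2 = P * P + 2" and v_3: "v 3 = P * (P * P + 2) + P"
  by (simp_all add: numeral_2_eq_2 numeral_3_eq_3)

lemma u_4: "u 4 = P * (P\<^sup>2 + 2)"
  using lucas_u_add4[of P 0] u_2 by simp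

text \<open>A shift by 4 only changes the sign modulo 3, so the terms 0, 1, \<open>P\<close>,
  \<open>P * P + 1\<close> at indices 0 to 3 decide; the last is 2 modulo 3.\<close>

lemma three_dvd_u_iff: "3 dvd u n \<longleftrightarrow> n mod 4 = 0"
proof -
  have "[u (n mod 4 + 4 * (n div 4)) = (- 1) ^ (n div 4) * u (n mod 4)] (mod 3)"
    by (rule cong_3[OF u_add_4mult])
  then have "3 dvd u n \<longleftrightarrow> 3 dvd (- 1) ^ (n div 4) * u (n mod 4)"
    by (simp add: cong_dvd_iff)
  also have "\<dots> \<longleftrightarrow> 3 dvd u (n mod 4)"
    by (cases "even (n div 4)") auto
  also have "\<dots> \<longleftrightarrow> n mod 4 = 0"
  proof -
    have "n mod 4 \<in> {0, 1, 2, 3}" by auto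
    moreover have "\<not> 3 dvd P * P + 1" using dvd_P_square by presburger
    ultimately show ?thesis using not_3_dvd_P by (auto simp: u_2 u_3)
  qed
  finally show ?thesis .
qed

lemma three_dvd_v_iff: "3 dvd v n \<longleftrightarrow> n mod 4 = 2"
proof -
  have "[v (n mod 4 + 4 * (n div 4)) = (- 1) ^ (n div 4) * v (n mod 4)] (mod 3)"
    by (rule cong_3[OF v_add_4mult])
  then have "3 dvd v n \<longleftrightarrow> 3 dvd (- 1) ^ (n div 4) * v (n mod 4)"
    by (simp add: cong_dvd_iff)
  also have "\<dots> \<longleftrightarrow> 3 dvd v (n mod 4)"
    by (cases "even (n div 4)") auto
  also have "\<dots> \<longleftrightarrow> n mod 4 = 2"
  proof -
    have "n mod 4 \<in> {0, 1, 2, 3}" by auto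
    moreover have "\<not> 3 dvd P * (P * P + 2) + P"
      using dvd_P_square not_3_dvd_P by (simp add: dvd_add_right_iff)
    ultimately show ?thesis using not_3_dvd_P dvd_P_square by (auto simp: v_2 v_3)
  qed
  finally show ?thesis .
qed

lemma power_Suc_dvd_u_12: "3 ^ (\<delta> + 1) dvd u 12"
proof -
  have "3 ^ \<delta> dvd u 4" using power_dvd by (simp add: u_4)
  moreover have "3 dvd D * (u 4)\<^sup>2 + 3"
    using three_dvd_u_iff[of 4] by (simp add: power2_eq_square)
  moreover have "u 12 = u 4 * (D * (u 4)\<^sup>2 + 3)" using lucas_u_triple[of 4 P] by simp
  ultimately show ?thesis by (simp add: mult_dvd_mono mult.commute[of 3])
qed

text \<open>Since \<open>u 12\<close> vanishes modulo \<open>3 ^ (\<delta> + 1)\<close>, the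
  addition formula makes a shift of the index by 12 a multiplication by the unit
  \<open>u 13\<close>. The induction thus descends from \<open>m\<close> to \<open>m - 3\<close>,
  with \<open>m = 0, 1, 2\<close> checked directly.\<close>

lemma power_Suc_dvd_u_iff: "3 ^ (\<delta> + 1) dvd u (4 * m) \<longleftrightarrow> 3 dvd m"
proof (induction m rule: less_induct)
  case (less m)
  show ?case
  proof (cases "m < 3")
    case True
    then have "m = 0 \<or> m = 1 \<or> m = 2" by auto
    moreover have "\<not> 3 ^ (\<delta> + 1) dvd u 4"
      unfolding u_4 power_3_dvd_mult_cancel[OF not_3_dvd_P] by (rule not_power_dvd)
    moreover have "\<not> 3 ^ (\<delta> + 1) dvd u 8"
    proof -
      have "u 8 = u 4 * v 4" using lucas_u_double[of P 4] by simp
      moreover have "\<not> 3 dvd v 4" by (simp add: three_dvd_v_iff)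
      ultimately show ?thesis
        using \<open>\<not> 3 ^ (\<delta> + 1) dvd u 4\<close> by (simp only: power_3_dvd_mult_cancel not_False_eq_True)
    qed
    ultimately show ?thesis by auto
  next
    case False
    then obtain j where j: "m = j + 3" by (metis add.commute le_Suc_ex not_less)
    have "u (4 * m) = u (Suc (4 * j)) * u 12 + u (4 * j) * (u 13 - P * u 12)"
      using lucas_u_add[of P "4 * j" 12] by (simp add: j algebra_simps)
    also have "\<dots> = u 12 * (u (Suc (4 * j)) - P * u (4 * j)) + u (4 * j) * u 13"
      by (simp add: algebra_simps)
    finally have "3 ^ (\<delta> + 1) dvd u (4 * m) \<longleftrightarrow> 3 ^ (\<delta> + 1) dvd u (4 * j) * u 13"
      using power_Suc_dvd_u_12 by (simp only: dvd_add_right_iff dvd_mult2)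
    also have "\<dots> \<longleftrightarrow> 3 ^ (\<delta> + 1) dvd u (4 * j)"
      by (rule power_3_dvd_mult_cancel) (simp add: three_dvd_u_iff)
    also have "\<dots> \<longleftrightarrow> 3 dvd j" using less.IH[of j] j by simp
    also have "\<dots> \<longleftrightarrow> 3 dvd m" by (simp add: j)
    finally show ?thesis .
  qed
qed

text \<open>Lifting the exponent: if 3 does not divide \<open>m\<close>, the valuation of
  \<open>u (4 * m)\<close> stays below \<open>\<delta> + 1\<close> by the previous lemma; each
  factor 3 of \<open>m\<close> adds exactly one by the tripling formula.\<close>

lemma power_dvd_u_iff: "3 ^ (\<delta> + e) dvd u (4 * m) \<longleftrightarrow> 3 ^ e dvd m"
proof (induction e arbitrary: m)
  case 0
  then show ?case using u_add_4mult[of 0 m] by (simp add: cong_0_iff)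
next
  case (Suc e)
  show ?case
  proof (cases "3 dvd m")
    case False
    then have "\<not> 3 ^ (\<delta> + 1) dvd u (4 * m)" by (simp only: power_Suc_dvd_u_iff) simp
    then have "\<not> 3 ^ (\<delta> + Suc e) dvd u (4 * m)"
      using power_le_dvd[of 3 "\<delta> + Suc e" "u (4 * m)" "\<delta> + 1"] by auto
    moreover have "\<not> 3 ^ Suc e dvd m" using False by (metis dvd_mult_left power_Suc)
    ultimately show ?thesis by blast
  next
    case True
    then obtain j where j: "m = 3 * j" by (elim dvdE)
    have "3 dvd u (4 * j)" by (simp add: three_dvd_u_iff)
    then obtain w where w: "u (4 * j) = 3 * w" by (elim dvdE)
    \<comment> \<open>As 9 divides the square of \<open>u (4 * j)\<close>, the cofactor in the
      tripling formula is 3 times a number congruent to 1 modulo 3.\<close>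
    define c where "c = 1 + 3 * (D * w\<^sup>2)"
    have "u (4 * m) = u (4 * j) * (D * (u (4 * j))\<^sup>2 + 3)"
      using lucas_u_triple[of "4 * j" P] by (simp add: j mult.left_commute)
    also have "D * (u (4 * j))\<^sup>2 + 3 = 3 * c"
      unfolding w c_def by (simp add: power2_eq_square algebra_simps)
    finally have "u (4 * m) = 3 * (u (4 * j) * c)" by simp
    then have "3 ^ (\<delta> + Suc e) dvd u (4 * m) \<longleftrightarrow> 3 ^ (\<delta> + e) dvd u (4 * j) * c"
      by simp
    also have "\<dots> \<longleftrightarrow> 3 ^ (\<delta> + e) dvd u (4 * j)"
      by (rule power_3_dvd_mult_cancel) (unfold c_def, presburger)
    also have "\<dots> \<longleftrightarrow> 3 ^ e dvd j" by (rule Suc)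
    finally show ?thesis by (simp add: j)
  qed
qed

lemma power_dvd_u_iff': "\<delta> \<le> k \<Longrightarrow> 3 ^ k dvd u (4 * m) \<longleftrightarrow> 3 ^ (k - \<delta>) dvd m"
  using power_dvd_u_iff[of "k - \<delta>" m] by simp

text \<open>In \<open>u (4 * m) = u (2 * m) * v (2 * m)\<close> the first factor is a unit modulo 3
  for odd \<open>m\<close>, so the whole valuation sits in the second.\<close>

lemma power_dvd_v_iff:
  assumes "odd m"
  shows "3 ^ (\<delta> + e) dvd v (2 * m) \<longleftrightarrow> 3 ^ e dvd m"
proof -
  have "(2 * m) mod 4 = 2" using assms by presburger
  then have "\<not> 3 dvd u (2 * m)" by (simp add: three_dvd_u_iff)
  moreover have "u (4 * m) = u (2 * m) * v (2 * m)" using lucas_u_double[of P "2 * m"] by simp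
  ultimately have "3 ^ (\<delta> + e) dvd u (4 * m) \<longleftrightarrow> 3 ^ (\<delta> + e) dvd v (2 * m)"
    by (simp add: power_3_dvd_mult_cancel)
  then show ?thesis using power_dvd_u_iff by simp
qed

section \<open>Periods modulo powers of 3\<close>

lemma u_8_cong_iff:
  assumes "\<delta> \<le> k" "n mod 4 \<noteq> 2"
  shows "[u (n + 8 * m) = u n] (mod 3 ^ k) \<longleftrightarrow> 3 ^ (k - \<delta>) dvd m"
proof -
  have "u (n + 8 * m) - u n = u (4 * m) * v (n + 4 * m)"
    using lucas_u_shift[of "4 * m" P n] by simp
  moreover have "\<not> 3 dvd v (n + 4 * m)" using assms by (simp add: three_dvd_v_iff)
  ultimately show ?thesis using assms(1)
    by (simp add: cong_iff_dvd_diff power_3_dvd_mult_cancel power_dvd_u_iff')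
qed

lemma v_8_cong_iff:
  assumes "\<delta> \<le> k" "n mod 4 \<noteq> 0"
  shows "[v (n + 8 * m) = v n] (mod 3 ^ k) \<longleftrightarrow> 3 ^ (k - \<delta>) dvd m"
proof -
  have "v (n + 8 * m) - v n = u (4 * m) * (D * u (n + 4 * m))"
    using lucas_v_shift[of "4 * m" P n] by simp
  moreover have "\<not> 3 dvd D * u (n + 4 * m)"
    using assms prime_dvd_mult_iff[OF prime_3_int] not_3_dvd_D by (simp add: three_dvd_u_iff)
  ultimately show ?thesis using assms(1)
    by (simp only: cong_iff_dvd_diff power_3_dvd_mult_cancel power_dvd_u_iff' not_False_eq_True)
qed

text \<open>A period preserves the zeros modulo 3, which gives \<open>4 dvd h\<close>; comparing
  signs at index 1 gives \<open>8 dvd h\<close>; the exact shift criterion at index 1 gives the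
  power of 3. The converse is the shift identity.\<close>

lemma u_period_iff:
  assumes "\<delta> \<le> k"
  shows "(\<forall>n. [u (n + h) = u n] (mod 3 ^ k)) \<longleftrightarrow> 8 * 3 ^ (k - \<delta>) dvd h"
proof
  assume per: "\<forall>n. [u (n + h) = u n] (mod 3 ^ k)"
  then have per3: "[u (n + h) = u n] (mod 3)" for n
    using assms by (blast intro: cong_3 cong_dvd_modulus le_imp_power_dvd)
  have "3 dvd u h" using per3[of 0] by (simp add: cong_0_iff)
  then have "4 dvd h" by (simp add: three_dvd_u_iff mod_eq_0_iff_dvd)
  then obtain i where i: "h = 4 * i" by (elim dvdE)
  have "[(- 1) ^ i * u 1 = u 1] (mod 3)"
    using cong_trans[OF cong_sym[OF cong_3[OF u_add_4mult[of 1 i]]]] per3[of 1] by (simp add: i)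
  then have "even i" by (rule even_if_cong_minus_one_power) simp
  then obtain m where m: "i = 2 * m" by (elim evenE)
  have "[u (1 + 8 * m) = u 1] (mod 3 ^ k)" using per[rule_format, of 1] by (simp add: i m)
  then have "3 ^ (k - \<delta>) dvd m" using u_8_cong_iff[OF assms, of 1 m] by simp
  then show "8 * 3 ^ (k - \<delta>) dvd h" by (simp add: i m)
next
  assume "8 * 3 ^ (k - \<delta>) dvd h"
  then obtain q where q: "h = 8 * 3 ^ (k - \<delta>) * q" by (elim dvdE)
  let ?m = "3 ^ (k - \<delta>) * q"
  have "u (n + h) - u n = u (4 * ?m) * v (n + 4 * ?m)" for n
    using lucas_u_shift[of "4 * ?m" P n] by (simp add: q mult.assoc)
  moreover have "3 ^ k dvd u (4 * ?m)" using power_dvd_u_iff'[OF assms] by simp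
  ultimately show "\<forall>n. [u (n + h) = u n] (mod 3 ^ k)" by (simp add: cong_iff_dvd_diff)
qed

text \<open>As for u, except that the zero modulo 3 is observed at index 2.\<close>

lemma v_period_iff:
  assumes "\<delta> \<le> k"
  shows "(\<forall>n. [v (n + h) = v n] (mod 3 ^ k)) \<longleftrightarrow> 8 * 3 ^ (k - \<delta>) dvd h"
proof
  assume per: "\<forall>n. [v (n + h) = v n] (mod 3 ^ k)"
  then have per3: "[v (n + h) = v n] (mod 3)" for n
    using assms by (blast intro: cong_3 cong_dvd_modulus le_imp_power_dvd)
  have "3 dvd v (2 + h)" using cong_dvd_iff[OF per3[of 2]] by (simp add: three_dvd_v_iff)
  then have "4 dvd h" unfolding three_dvd_v_iff by presburger
  then obtain i where i: "h = 4 * i" by (elim dvdE)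
  have "[(- 1) ^ i * v 1 = v 1] (mod 3)"
    using cong_trans[OF cong_sym[OF cong_3[OF v_add_4mult[of 1 i]]]] per3[of 1] by (simp add: i)
  then have "even i" by (rule even_if_cong_minus_one_power) (simp add: not_3_dvd_P)
  then obtain m where m: "i = 2 * m" by (elim evenE)
  have "[v (1 + 8 * m) = v 1] (mod 3 ^ k)" using per[rule_format, of 1] by (simp add: i m)
  then have "3 ^ (k - \<delta>) dvd m" using v_8_cong_iff[OF assms, of 1 m] by simp
  then show "8 * 3 ^ (k - \<delta>) dvd h" by (simp add: i m)
next
  assume "8 * 3 ^ (k - \<delta>) dvd h"
  then obtain q where q: "h = 8 * 3 ^ (k - \<delta>) * q" by (elim dvdE)
  let ?m = "3 ^ (k - \<delta>) * q"
  have "v (n + h) - v n = D * u (4 * ?m) * u (n + 4 * ?m)" for n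
    using lucas_v_shift[of "4 * ?m" P n] by (simp add: q mult.assoc)
  moreover have "3 ^ k dvd u (4 * ?m)" using power_dvd_u_iff'[OF assms] by simp
  ultimately show "\<forall>n. [v (n + h) = v n] (mod 3 ^ k)" by (simp add: cong_iff_dvd_diff)
qed

lemma h_u_eq: "\<delta> \<le> k \<Longrightarrow> h_u P (3 ^ k) = 8 * 3 ^ (k - \<delta>)"
  unfolding h_u_def min_period_def using u_period_iff[of k]
  by (intro Least_equality) (auto intro: dvd_imp_le)

lemma h_v_eq: "\<delta> \<le> k \<Longrightarrow> h_v P (3 ^ k) = 8 * 3 ^ (k - \<delta>)"
  unfolding h_v_def min_period_def using v_period_iff[of k]
  by (intro Least_equality) (auto intro: dvd_imp_le)

end

section \<open>Numbers of occurrences\<close>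

context lucas_3
begin

text \<open>A general predicate \<open>Q\<close> is allowed because two uses are intended: plain
  congruence to \<open>b\<close> when counting values of u, and a quadratic congruence when u serves
  as the companion in the critical classes of v.\<close>

lemma card_u_transport:
  assumes "\<delta> \<le> k" "r mod 4 \<noteq> 2" and "\<And>x y. [x = y] (mod 3 ^ k) \<Longrightarrow> Q x \<longleftrightarrow> Q y"
  shows "card {j. j < 3 ^ (k - \<delta>) \<and> Q (u (r + 8 * j))}
    = card {y \<in> {0..<3 ^ k}. [y = u r] (mod 3 ^ \<delta>) \<and> Q y}"
proof -
  have inj: "i = j" if "i < 3 ^ (k - \<delta>)" "j < 3 ^ (k - \<delta>)"
    "[u (r + 8 * i) = u (r + 8 * j)] (mod 3 ^ k)" for i j
  proof (rule index_eq_if_cong[OF _ that])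
    fix i m assume "[u (r + 8 * (i + m)) = u (r + 8 * i)] (mod 3 ^ k)"
    moreover have "(r + 8 * i) mod 4 \<noteq> 2" using assms(2) by presburger
    ultimately show "3 ^ (k - \<delta>) dvd m"
      using u_8_cong_iff[OF assms(1), of "r + 8 * i" m] by (simp add: algebra_simps)
  qed
  show ?thesis
    by (rule card_transport[OF assms(1), of 3 "\<lambda>j. u (r + 8 * j)" "u r" Q, unfolded nat_3_power])
      (simp, fact inj, rule u_add_8mult, fact assms(3))
qed

lemma card_v_transport:
  assumes "\<delta> \<le> k" "r mod 4 \<noteq> 0" and "\<And>x y. [x = y] (mod 3 ^ k) \<Longrightarrow> Q x \<longleftrightarrow> Q y"
  shows "card {j. j < 3 ^ (k - \<delta>) \<and> Q (v (r + 8 * j))}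
    = card {y \<in> {0..<3 ^ k}. [y = v r] (mod 3 ^ \<delta>) \<and> Q y}"
proof -
  have inj: "i = j" if "i < 3 ^ (k - \<delta>)" "j < 3 ^ (k - \<delta>)"
    "[v (r + 8 * i) = v (r + 8 * j)] (mod 3 ^ k)" for i j
  proof (rule index_eq_if_cong[OF _ that])
    fix i m assume "[v (r + 8 * (i + m)) = v (r + 8 * i)] (mod 3 ^ k)"
    moreover have "(r + 8 * i) mod 4 \<noteq> 0" using assms(2) by presburger
    ultimately show "3 ^ (k - \<delta>) dvd m"
      using v_8_cong_iff[OF assms(1), of "r + 8 * i" m] by (simp add: algebra_simps)
  qed
  show ?thesis
    by (rule card_transport[OF assms(1), of 3 "\<lambda>j. v (r + 8 * j)" "v r" Q, unfolded nat_3_power])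
      (simp, fact inj, rule v_add_8mult, fact assms(3))
qed

lemma card_u_regular:
  assumes "\<delta> \<le> k" "r mod 4 \<noteq> 2"
  shows "card {j. j < 3 ^ (k - \<delta>) \<and> [u (r + 8 * j) = b] (mod 3 ^ k)}
    = (if [b = u r] (mod 3 ^ \<delta>) then 1 else 0)"
  unfolding card_cong_both[OF assms(1), symmetric]
  by (rule card_u_transport[OF assms]) (meson cong_sym cong_trans)

lemma card_v_regular:
  assumes "\<delta> \<le> k" "r mod 4 \<noteq> 0"
  shows "card {j. j < 3 ^ (k - \<delta>) \<and> [v (r + 8 * j) = b] (mod 3 ^ k)}
    = (if [b = v r] (mod 3 ^ \<delta>) then 1 else 0)"
  unfolding card_cong_both[OF assms(1), symmetric]
  by (rule card_v_transport[OF assms]) (meson cong_sym cong_trans)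

lemma v_square_even: "even n \<Longrightarrow> (v n)\<^sup>2 = D * (u n)\<^sup>2 + 4"
  using lucas_v_square[of P n] by simp

lemma D_square_cong_iff:
  "[D * b\<^sup>2 + 4 = D * t\<^sup>2 + 4] (mod 3 ^ j) \<longleftrightarrow> [b\<^sup>2 = t\<^sup>2] (mod 3 ^ j)"
proof -
  have "D * b\<^sup>2 + 4 - (D * t\<^sup>2 + 4) = D * (b\<^sup>2 - t\<^sup>2)" by (simp add: algebra_simps)
  then show ?thesis by (simp only: cong_iff_dvd_diff power_3_dvd_mult_cancel[OF not_3_dvd_D])
qed

text \<open>The classes that are critical for u are regular for v. Squaring replaces the condition
  on u by one on v, to which the transport for v applies.\<close>

lemma card_u_critical:
  assumes "\<delta> \<le> k" "r mod 4 = 2"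
  shows "card {j. j < 3 ^ (k - \<delta>) \<and> [u (r + 8 * j) = b] (mod 3 ^ k)}
    = (if [b = u r] (mod 3) then card (square_sols 1 (D * b\<^sup>2 + 4) \<delta> k) else 0)"
proof -
  have iff: "[u (r + 8 * j) = b] (mod 3 ^ k) \<longleftrightarrow>
    [b = u r] (mod 3) \<and> [1 * (v (r + 8 * j))\<^sup>2 = D * b\<^sup>2 + 4] (mod 3 ^ k)" for j
  proof -
    have m: "(r + 8 * j) mod 4 = 2" "even (r + 8 * j)" using assms(2) by presburger+
    then have "\<not> 3 dvd u (r + 8 * j)" by (simp add: three_dvd_u_iff)
    from cong_iff_cong_3_and_squares[OF this _ cong_3[OF u_add_8mult], of k b]
    have "[u (r + 8 * j) = b] (mod 3 ^ k) \<longleftrightarrow> [b = u r] (mod 3) \<and> [b\<^sup>2 = (u (r + 8 * j))\<^sup>2] (mod 3 ^ k)"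
      using assms(1) \<delta>_pos by simp
    moreover have "[1 * (v (r + 8 * j))\<^sup>2 = D * b\<^sup>2 + 4] (mod 3 ^ k) \<longleftrightarrow> [b\<^sup>2 = (u (r + 8 * j))\<^sup>2] (mod 3 ^ k)"
      unfolding mult_1 v_square_even[OF m(2)] D_square_cong_iff by (rule cong_sym_eq)
    ultimately show ?thesis by blast
  qed
  have "r mod 4 \<noteq> 0" using assms(2) by simp
  \<comment> \<open>The index is twice an odd number, so \<open>v r\<close> is a multiple of
    \<open>3 ^ \<delta>\<close> and its class modulo \<open>3 ^ \<delta>\<close> consists of the
    multiples, as in \<open>square_sols\<close>.\<close>
  have "r = 2 * (2 * (r div 4) + 1)" using assms(2) by presburger
  then have "3 ^ \<delta> dvd v r"
    using power_dvd_v_iff[of "2 * (r div 4) + 1" 0] by simp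
  then have "card {j. j < 3 ^ (k - \<delta>) \<and> [1 * (v (r + 8 * j))\<^sup>2 = D * b\<^sup>2 + 4] (mod 3 ^ k)}
    = card (square_sols 1 (D * b\<^sup>2 + 4) \<delta> k)"
    unfolding square_sols_def cong_multiple_iff[OF \<open>3 ^ \<delta> dvd v r\<close>, symmetric]
    by (intro card_v_transport[OF assms(1) \<open>r mod 4 \<noteq> 0\<close>] cong_scaled_square)
  then show ?thesis unfolding iff by simp
qed

text \<open>The mirror image, with u as the regular companion; the coefficient \<open>D\<close> of
  the square of u remains in the quadratic congruence.\<close>

lemma card_v_critical:
  assumes "\<delta> \<le> k" "r mod 4 = 0"
  shows "card {j. j < 3 ^ (k - \<delta>) \<and> [v (r + 8 * j) = b] (mod 3 ^ k)}
    = (if [b = v r] (mod 3) then card (square_sols D (b\<^sup>2 - 4) \<delta> k) else 0)"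
proof -
  have iff: "[v (r + 8 * j) = b] (mod 3 ^ k) \<longleftrightarrow>
    [b = v r] (mod 3) \<and> [D * (u (r + 8 * j))\<^sup>2 = b\<^sup>2 - 4] (mod 3 ^ k)" for j
  proof -
    have m: "(r + 8 * j) mod 4 \<noteq> 2" "even (r + 8 * j)" using assms(2) by presburger+
    then have "\<not> 3 dvd v (r + 8 * j)" by (simp add: three_dvd_v_iff)
    from cong_iff_cong_3_and_squares[OF this _ cong_3[OF v_add_8mult], of k b]
    have "[v (r + 8 * j) = b] (mod 3 ^ k) \<longleftrightarrow> [b = v r] (mod 3) \<and> [b\<^sup>2 = (v (r + 8 * j))\<^sup>2] (mod 3 ^ k)"
      using assms(1) \<delta>_pos by simp
    moreover have "[D * (u (r + 8 * j))\<^sup>2 = b\<^sup>2 - 4] (mod 3 ^ k) \<longleftrightarrow> [b\<^sup>2 = (v (r + 8 * j))\<^sup>2] (mod 3 ^ k)"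
      unfolding v_square_even[OF m(2)]
      by (subst cong_sym_eq) (simp only: cong_iff_dvd_diff diff_diff_eq add.commute)
    ultimately show ?thesis by blast
  qed
  have "r mod 4 \<noteq> 2" using assms(2) by simp
  have "3 ^ \<delta> dvd u r"
    using power_dvd_u_iff[of 0 "r div 4"] assms(2) by (simp add: mod_eq_0_iff_dvd)
  then have "card {j. j < 3 ^ (k - \<delta>) \<and> [D * (u (r + 8 * j))\<^sup>2 = b\<^sup>2 - 4] (mod 3 ^ k)}
    = card (square_sols D (b\<^sup>2 - 4) \<delta> k)"
    unfolding square_sols_def cong_multiple_iff[OF \<open>3 ^ \<delta> dvd u r\<close>, symmetric]
    by (intro card_u_transport[OF assms(1) \<open>r mod 4 \<noteq> 2\<close>] cong_scaled_square)
  then show ?thesis unfolding iff by simp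
qed

section \<open>Summation over the eight residue classes of the index\<close>

lemma u_residues:
  "[u 3 = - 1] (mod 3 ^ \<delta>)" "[u 4 = 0] (mod 3 ^ \<delta>)" "[u 5 = - 1] (mod 3 ^ \<delta>)"
  "[u 6 = - P] (mod 3 ^ \<delta>)" "[u 7 = 1] (mod 3 ^ \<delta>)"
proof -
  show 3: "[u 3 = - 1] (mod 3 ^ \<delta>)"
    using power_dvd by (simp add: u_3 cong_iff_dvd_diff power2_eq_square add.commute)
  show "[u 4 = 0] (mod 3 ^ \<delta>)" "[u 5 = - 1] (mod 3 ^ \<delta>)" "[u 6 = - P] (mod 3 ^ \<delta>)"
    using u_add4[of 0] u_add4[of 1] u_add4[of 2] by (simp_all add: u_2)
  have "[- u 3 = - (- 1)] (mod 3 ^ \<delta>)" using 3 by (simp only: cong_minus_minus_iff)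
  then show "[u 7 = 1] (mod 3 ^ \<delta>)" using cong_trans[OF u_add4[of 3]] by simp
qed

lemma v_residues:
  "[v 2 = 0] (mod 3 ^ \<delta>)" "[v 3 = P] (mod 3 ^ \<delta>)" "[v 4 = - 2] (mod 3 ^ \<delta>)"
  "[v 5 = - P] (mod 3 ^ \<delta>)" "[v 6 = 0] (mod 3 ^ \<delta>)" "[v 7 = - P] (mod 3 ^ \<delta>)"
proof -
  show 2: "[v 2 = 0] (mod 3 ^ \<delta>)" and 3: "[v 3 = P] (mod 3 ^ \<delta>)"
    using power_dvd by (simp_all add: v_2 v_3 cong_iff_dvd_diff power2_eq_square)
  show "[v 4 = - 2] (mod 3 ^ \<delta>)" "[v 5 = - P] (mod 3 ^ \<delta>)"
    using v_add4[of 0] v_add4[of 1] by simp_all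
  have "[- v 2 = - 0] (mod 3 ^ \<delta>)" using 2 by (simp only: cong_minus_minus_iff)
  then show "[v 6 = 0] (mod 3 ^ \<delta>)" using cong_trans[OF v_add4[of 2]] by simp
  have "[- v 3 = - P] (mod 3 ^ \<delta>)" using 3 by (simp only: cong_minus_minus_iff)
  then show "[v 7 = - P] (mod 3 ^ \<delta>)" using cong_trans[OF v_add4[of 3]] by simp
qed

text \<open>The residues 0, \<open>e\<close> and \<open>- e\<close> are distinct modulo 3, so at
  most one indicator is 1. The factors 2 arise because the six regular classes modulo 8 hit each of
  the three residues twice.\<close>

lemma cong_0_pm_count:
  fixes b e :: int
  assumes "\<not> 3 dvd e"
  defines "I \<equiv> \<lambda>c. if [b = c] (mod 3 ^ \<delta>) then 1 else 0 :: nat"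
  shows "2 * I 0 + 2 * I e + 2 * I (- e)
    = (if [b = 0] (mod 3 ^ \<delta>) \<or> cong_pm b e (3 ^ \<delta>) then 2 else 0)"
proof -
  have "\<not> ([b = 0] (mod 3) \<and> [b = e] (mod 3))" "\<not> ([b = 0] (mod 3) \<and> [b = - e] (mod 3))"
    "\<not> ([b = e] (mod 3) \<and> [b = - e] (mod 3))"
    using assms(1) unfolding cong_iff_dvd_diff by - presburger+
  then have "\<not> ([b = 0] (mod 3 ^ \<delta>) \<and> [b = e] (mod 3 ^ \<delta>))"
    "\<not> ([b = 0] (mod 3 ^ \<delta>) \<and> [b = - e] (mod 3 ^ \<delta>))"
    "\<not> ([b = e] (mod 3 ^ \<delta>) \<and> [b = - e] (mod 3 ^ \<delta>))"
    using cong_3 by blast+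
  then show ?thesis by (auto simp: I_def)
qed

lemma not_3_dvd_imp_not_power_dvd: "\<not> 3 dvd x \<Longrightarrow> \<not> 3 ^ \<delta> dvd (x::int)"
  using \<delta>_pos by (metis dvd_power dvd_trans less_le_trans zero_less_one)

text \<open>The six regular classes contribute indicators. The critical classes 2 and 6 have values
  \<open>P\<close> and \<open>- P\<close> modulo 3 and the same solution set, so together they
  contribute it exactly once.\<close>

lemma v_u_eq:
  assumes "\<delta> \<le> k"
  shows "v_u P (3 ^ k) b = (if [b = 0] (mod 3 ^ \<delta>) \<or> cong_pm b 1 (3 ^ \<delta>) then 2 else 0)
    + card (square_sols 1 (D * b\<^sup>2 + 4) \<delta> k)"
proof -
  let ?S = "card (square_sols 1 (D * b\<^sup>2 + 4) \<delta> k)"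
  let ?N = "\<lambda>r. card {j. j < 3 ^ (k - \<delta>) \<and> [u (r + 8 * j) = b] (mod 3 ^ k)}"
  let ?I = "\<lambda>c. if [b = c] (mod 3 ^ \<delta>) then 1 else 0 :: nat"
  have "v_u P (3 ^ k) b = (\<Sum>r<8. ?N r)"
    unfolding v_u_def h_u_eq[OF assms] card_split_residues by simp
  also have "\<dots> = ?N 0 + ?N 1 + ?N 2 + ?N 3 + ?N 4 + ?N 5 + ?N 6 + ?N 7"
    by (simp add: eval_nat_numeral)
  also have "\<dots> = ?I 0 + ?I 1 + ?N 2 + ?I (- 1) + ?I 0 + ?I (- 1) + ?N 6 + ?I 1"
  proof -
    have 1: "?N 0 = ?I 0"
      using card_u_regular[OF assms, of 0 b] by simp
    have 2: "?N 1 = ?I 1"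
      using card_u_regular[OF assms, of 1 b] by simp
    have 3: "?N 3 = ?I (- 1)"
      using card_u_regular[OF assms, of 3 b] unfolding cong_target[OF u_residues(1)] by simp
    have 4: "?N 4 = ?I 0"
      using card_u_regular[OF assms, of 4 b] unfolding cong_target[OF u_residues(2)] by simp
    have 5: "?N 5 = ?I (- 1)"
      using card_u_regular[OF assms, of 5 b] unfolding cong_target[OF u_residues(3)] by simp
    have 6: "?N 7 = ?I 1"
      using card_u_regular[OF assms, of 7 b] unfolding cong_target[OF u_residues(5)] by simp
    show ?thesis by (simp only: 1 2 3 4 5 6)
  qed
  also have "?N 2 = (if [b = P] (mod 3) then ?S else 0)"
    using card_u_critical[OF assms, of 2 b] by (simp add: u_2)
  also have "?N 6 = (if [b = - P] (mod 3) then ?S else 0)"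
    using card_u_critical[OF assms, of 6 b] cong_target[OF cong_3[OF u_residues(4)], of b] by simp
  finally have "v_u P (3 ^ k) b = 2 * ?I 0 + 2 * ?I 1 + 2 * ?I (- 1)
    + ((if [b = P] (mod 3) then ?S else 0) + (if [b = - P] (mod 3) then ?S else 0))"
    by simp
  \<comment> \<open>For \<open>3 dvd b\<close> the right-hand side of the quadratic congruence is 4
    modulo 3, so no multiple of \<open>3 ^ \<delta>\<close> solves it.\<close>
  also have "(if [b = P] (mod 3) then ?S else 0) + (if [b = - P] (mod 3) then ?S else 0) = ?S"
  proof (rule cong_pm_split_3[OF not_3_dvd_P])
    assume "3 dvd b"
    then have "3 dvd D * b\<^sup>2" by (simp add: power2_eq_square)
    then have "\<not> 3 dvd D * b\<^sup>2 + 4" by presburger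
    then show "?S = 0"
      using square_sols_empty_if_not_dvd[OF not_3_dvd_imp_not_power_dvd assms] by simp
  qed
  also have "2 * ?I 0 + 2 * ?I 1 + 2 * ?I (- 1) =
    (if [b = 0] (mod 3 ^ \<delta>) \<or> cong_pm b 1 (3 ^ \<delta>) then 2 else 0)"
    by (rule cong_0_pm_count) simp
  finally show ?thesis .
qed

lemma v_v_eq:
  assumes "\<delta> \<le> k"
  shows "v_v P (3 ^ k) b = (if [b = 0] (mod 3 ^ \<delta>) \<or> cong_pm b P (3 ^ \<delta>) then 2 else 0)
    + card (square_sols D (b\<^sup>2 - 4) \<delta> k)"
proof -
  let ?S = "card (square_sols D (b\<^sup>2 - 4) \<delta> k)"
  let ?N = "\<lambda>r. card {j. j < 3 ^ (k - \<delta>) \<and> [v (r + 8 * j) = b] (mod 3 ^ k)}"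
  let ?I = "\<lambda>c. if [b = c] (mod 3 ^ \<delta>) then 1 else 0 :: nat"
  have "v_v P (3 ^ k) b = (\<Sum>r<8. ?N r)"
    unfolding v_v_def h_v_eq[OF assms] card_split_residues by simp
  also have "\<dots> = ?N 0 + ?N 1 + ?N 2 + ?N 3 + ?N 4 + ?N 5 + ?N 6 + ?N 7"
    by (simp add: eval_nat_numeral)
  also have "\<dots> = ?N 0 + ?I P + ?I 0 + ?I P + ?N 4 + ?I (- P) + ?I 0 + ?I (- P)"
  proof -
    have 1: "?N 1 = ?I P"
      using card_v_regular[OF assms, of 1 b] by simp
    have 2: "?N 2 = ?I 0"
      using card_v_regular[OF assms, of 2 b] unfolding cong_target[OF v_residues(1)] by simp
    have 3: "?N 3 = ?I P"
      using card_v_regular[OF assms, of 3 b] unfolding cong_target[OF v_residues(2)] by simp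
    have 4: "?N 5 = ?I (- P)"
      using card_v_regular[OF assms, of 5 b] unfolding cong_target[OF v_residues(4)] by simp
    have 5: "?N 6 = ?I 0"
      using card_v_regular[OF assms, of 6 b] unfolding cong_target[OF v_residues(5)] by simp
    have 6: "?N 7 = ?I (- P)"
      using card_v_regular[OF assms, of 7 b] unfolding cong_target[OF v_residues(6)] by simp
    show ?thesis by (simp only: 1 2 3 4 5 6)
  qed
  also have "?N 0 = (if [b = 2] (mod 3) then ?S else 0)"
    using card_v_critical[OF assms, of 0 b] by simp
  also have "?N 4 = (if [b = - 2] (mod 3) then ?S else 0)"
    using card_v_critical[OF assms, of 4 b] cong_target[OF cong_3[OF v_residues(3)], of b] by simp
  finally have "v_v P (3 ^ k) b = 2 * ?I 0 + 2 * ?I P + 2 * ?I (- P)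
    + ((if [b = 2] (mod 3) then ?S else 0) + (if [b = - 2] (mod 3) then ?S else 0))"
    by simp
  also have "(if [b = 2] (mod 3) then ?S else 0) + (if [b = - 2] (mod 3) then ?S else 0) = ?S"
  proof (rule cong_pm_split_3)
    assume "3 dvd b"
    then have "3 dvd b\<^sup>2" by (simp add: power2_eq_square)
    then have "\<not> 3 dvd b\<^sup>2 - 4" by presburger
    then show "?S = 0"
      using square_sols_empty_if_not_dvd[OF not_3_dvd_imp_not_power_dvd assms] by simp
  qed simp
  also have "2 * ?I 0 + 2 * ?I P + 2 * ?I (- P) =
    (if [b = 0] (mod 3 ^ \<delta>) \<or> cong_pm b P (3 ^ \<delta>) then 2 else 0)"
    by (rule cong_0_pm_count[OF not_3_dvd_P])
  finally show ?thesis .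
qed

section \<open>Translation of the listed residues into conditions on the quadratic
  congruence\<close>

lemma cong_pm_u_iff:
  assumes "odd m"
  shows "cong_pm b (u (2 * m)) (3 ^ j) \<longleftrightarrow> [D * b\<^sup>2 + 4 = (v (2 * m))\<^sup>2] (mod 3 ^ j)"
proof -
  have "(2 * m) mod 4 \<noteq> 0" using assms by presburger
  then have "\<not> 3 dvd u (2 * m)" by (simp add: three_dvd_u_iff)
  then show ?thesis
    by (simp only: cong_pm_iff_squares v_square_even dvd_triv_left D_square_cong_iff not_False_eq_True)
qed

lemma cong_pm_v_iff:
  "cong_pm b (v (4 * m)) (3 ^ j) \<longleftrightarrow> [b\<^sup>2 - 4 = D * (u (4 * m))\<^sup>2] (mod 3 ^ j)"
proof -
  have "\<not> 3 dvd v (4 * m)" by (simp add: three_dvd_v_iff)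
  from cong_pm_iff_squares[OF this, of b j] v_square_even[of "4 * m"]
  have "cong_pm b (v (4 * m)) (3 ^ j) \<longleftrightarrow> [b\<^sup>2 = D * (u (4 * m))\<^sup>2 + 4] (mod 3 ^ j)" by simp
  then show ?thesis
    by (simp only: cong_iff_dvd_diff diff_diff_eq add.commute)
qed

text \<open>The valuation of \<open>v (2 * 3 ^ e)\<close> is at least \<open>\<delta> + e\<close>,
  so its square vanishes modulo \<open>3 ^ k\<close>.\<close>

lemma cong_pm_u_critical_iff:
  assumes "k \<le> 2 * (\<delta> + e)"
  shows "cong_pm b (u (2 * 3 ^ e)) (3 ^ k) \<longleftrightarrow> [D * b\<^sup>2 + 4 = 0] (mod 3 ^ k)"
proof -
  have "3 ^ (\<delta> + e) dvd v (2 * 3 ^ e)" by (simp add: power_dvd_v_iff)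
  from cong_target[OF square_cong_0[OF this assms]] show ?thesis
    by (simp add: cong_pm_u_iff)
qed

text \<open>The index is chosen so that v has valuation exactly \<open>l\<close> there; its square
  is then \<open>3 ^ (2 * l)\<close> up to a unit square, which is 1 modulo 3.\<close>

lemma cong_pm_u_unit_iff:
  assumes "\<delta> \<le> l"
  shows "cong_pm b (u (2 * 3 ^ (l - \<delta>))) (3 ^ (2 * l + 1)) \<longleftrightarrow>
    [D * b\<^sup>2 + 4 = 1 * 3 ^ (2 * l)] (mod 3 ^ (2 * l + 1))"
proof -
  have "3 ^ l dvd v (2 * 3 ^ (l - \<delta>))" "\<not> 3 ^ (l + 1) dvd v (2 * 3 ^ (l - \<delta>))"
    using power_dvd_v_iff[of "3 ^ (l - \<delta>)" "l - \<delta>"] power_dvd_v_iff[of "3 ^ (l - \<delta>)" "l - \<delta> + 1"] assms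
    by (simp_all add: power_dvd_imp_le)
  from cong_target[OF square_cong_exact_power[OF this], of "D * b\<^sup>2 + 4"]
    cong_pm_u_iff[of "3 ^ (l - \<delta>)" b "2 * l + 1"]
  show ?thesis by simp
qed

text \<open>The case of index 0, where v is 2 and u vanishes.\<close>

lemma cong_pm_v_critical_iff: "cong_pm b 2 (3 ^ k) \<longleftrightarrow> [b\<^sup>2 - 4 = 0] (mod 3 ^ k)"
  using cong_pm_v_iff[of b 0 k] by simp

lemma cong_pm_v_unit_iff:
  assumes "\<delta> \<le> l"
  shows "cong_pm b (v (4 * 3 ^ (l - \<delta>))) (3 ^ (2 * l + 1)) \<longleftrightarrow>
    [b\<^sup>2 - 4 = D * 3 ^ (2 * l)] (mod 3 ^ (2 * l + 1))"
proof -
  have "3 ^ l dvd u (4 * 3 ^ (l - \<delta>))" "\<not> 3 ^ (l + 1) dvd u (4 * 3 ^ (l - \<delta>))"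
    using power_dvd_u_iff[of "l - \<delta>" "3 ^ (l - \<delta>)"] power_dvd_u_iff[of "l - \<delta> + 1" "3 ^ (l - \<delta>)"] assms
    by (simp_all add: power_dvd_imp_le)
  from cong_target[OF cong_scalar_left[OF square_cong_exact_power[OF this], of D], of "b\<^sup>2 - 4"]
    cong_pm_v_iff[of b "3 ^ (l - \<delta>)" "2 * l + 1"]
  show ?thesis by simp
qed

lemma not_power_dvd_6:
  assumes "\<delta> \<ge> 2"
  shows "\<not> 3 ^ \<delta> dvd (6::int)"
proof
  assume "3 ^ \<delta> dvd (6::int)"
  then have "3 ^ 2 dvd (6::int)" using assms by (rule power_le_dvd)
  then show False by simp
qed

text \<open>Separates regular from critical residues: modulo \<open>3 ^ \<delta>\<close> the
  quantity \<open>D * b\<^sup>2 + 4\<close> is 4 if \<open>b\<close> is 0, and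
  \<open>P^2 + 8\<close>, that is 6, if \<open>b\<close> is 1 or -1. Neither vanishes when 9 divides
  the modulus.\<close>

lemma not_power_dvd_discriminant_u:
  assumes "\<delta> \<ge> 2" "[b = 0] (mod 3 ^ \<delta>) \<or> cong_pm b 1 (3 ^ \<delta>)"
  shows "\<not> 3 ^ \<delta> dvd D * b\<^sup>2 + 4"
proof
  assume *: "3 ^ \<delta> dvd D * b\<^sup>2 + 4"
  consider "[b\<^sup>2 = 0] (mod 3 ^ \<delta>)" | "[b\<^sup>2 = 1] (mod 3 ^ \<delta>)"
    using assms(2) cong_pow[of b _ "3 ^ \<delta>" 2] by fastforce
  then show False
  proof cases
    case 1
    then have "3 ^ \<delta> dvd D * b\<^sup>2" by (simp add: cong_0_iff)
    with * have "3 ^ \<delta> dvd (4::int)" by (simp add: dvd_add_right_iff)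
    then show False using not_3_dvd_imp_not_power_dvd[of 4] by simp
  next
    case 2
    then have "3 ^ \<delta> dvd D * (b\<^sup>2 - 1)" by (simp add: cong_iff_dvd_diff)
    from dvd_diff[OF dvd_diff[OF * this] power_dvd] have "3 ^ \<delta> dvd (6::int)"
      by (simp add: algebra_simps)
    then show False using not_power_dvd_6 assms(1) by blast
  qed
qed

text \<open>Here the values modulo \<open>3 ^ \<delta>\<close> are -4, and \<open>P^2 - 4\<close>,
  that is -6.\<close>

lemma not_power_dvd_discriminant_v:
  assumes "\<delta> \<ge> 2" "[b = 0] (mod 3 ^ \<delta>) \<or> cong_pm b P (3 ^ \<delta>)"
  shows "\<not> 3 ^ \<delta> dvd b\<^sup>2 - 4"
proof
  assume *: "3 ^ \<delta> dvd b\<^sup>2 - 4"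
  consider "[b\<^sup>2 = 0] (mod 3 ^ \<delta>)" | "[b\<^sup>2 = P\<^sup>2] (mod 3 ^ \<delta>)"
    using assms(2) cong_pow[of b _ "3 ^ \<delta>" 2] by fastforce
  then show False
  proof cases
    case 1
    then have "3 ^ \<delta> dvd b\<^sup>2" by (simp add: cong_0_iff)
    from dvd_diff[OF this *] have "3 ^ \<delta> dvd (4::int)" by simp
    then show False using not_3_dvd_imp_not_power_dvd[of 4] by simp
  next
    case 2
    then have "3 ^ \<delta> dvd b\<^sup>2 - P\<^sup>2" by (simp add: cong_iff_dvd_diff)
    from dvd_diff[OF dvd_add[OF this power_dvd] *] have "3 ^ \<delta> dvd (6::int)"
      by (simp add: algebra_simps)
    then show False using not_power_dvd_6 assms(1) by blast
  qed
qed

text \<open>\<open>B\<close> holds for the residues taken at the indices where the companion factor is a unit; the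
  solutions of \<open>C y\<^sup>2 \<equiv> A\<close> account for the remaining indices.\<close>
lemma count_cases:
  assumes k: "\<delta> \<le> k" and C: "\<not> 3 dvd C"
    and n: "n = (if B then 2 else 0) + card (square_sols C A \<delta> k)"
    and B1: "\<delta> = 1 \<longrightarrow> B" and B2: "\<delta> \<ge> 2 \<longrightarrow> B \<longrightarrow> \<not> 3 ^ \<delta> dvd A"
    and X: "X \<longleftrightarrow> [A = 0] (mod 3 ^ k)"
    and Y: "\<forall>l\<ge>\<delta>. Y l \<longleftrightarrow> [A = C * 3 ^ (2 * l)] (mod 3 ^ (2 * l + 1))"
  shows "X \<Longrightarrow> 2 * \<delta> - 1 \<le> k \<Longrightarrow> n = 3 ^ (k div 2) + (if \<delta> = 1 then 2 else 0)"
    and "X \<Longrightarrow> k < 2 * \<delta> - 1 \<Longrightarrow> n = 3 ^ (k - \<delta>)"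
    and "l \<in> {\<delta>..(k - 1) div 2} \<Longrightarrow> Y l \<Longrightarrow> n = 2 * 3 ^ l + (if \<delta> = 1 then 2 else 0)"
    and "\<delta> \<ge> 2 \<Longrightarrow> B \<Longrightarrow> n = 2"
    and "\<not> X \<Longrightarrow> \<forall>l\<in>{\<delta>..(k - 1) div 2}. \<not> Y l \<Longrightarrow> n = (if B then 2 else 0)"
    and "\<not> X \<Longrightarrow> k < 2 * \<delta> - 1 \<Longrightarrow> n = (if B then 2 else 0)"
proof -
  have notB: "\<not> B" if "3 ^ \<delta> dvd A" "\<delta> \<noteq> 1"
    using that B2 \<delta>_pos by fastforce
  \<comment> \<open>Under \<open>X\<close> the power \<open>3 ^ \<delta>\<close> divides
    \<open>A\<close>, which excludes \<open>B\<close> unless \<open>\<delta> = 1\<close>, where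
    \<open>B\<close> always holds. The summand 2 therefore appears exactly for
    \<open>\<delta> = 1\<close>.\<close>
  have X_B: "(if B then 2 else 0) = (if \<delta> = 1 then 2 else 0 :: nat)" if X
    using that notB B1 power_dvd_if_cong_0[OF _ k, of A] X by auto
  show "n = 3 ^ (k div 2) + (if \<delta> = 1 then 2 else 0)" if X "2 * \<delta> - 1 \<le> k"
    using that card_square_sols_0_large[OF C _ k, of A] X X_B n by simp
  show "n = 3 ^ (k - \<delta>)" if X "k < 2 * \<delta> - 1"
    using that card_square_sols_0_small[OF C _ k, of A] X X_B n k by auto
  show "n = 2 * 3 ^ l + (if \<delta> = 1 then 2 else 0)" if l: "l \<in> {\<delta>..(k - 1) div 2}" and "Y l"
  proof -
    have *: "[A = C * 3 ^ (2 * l)] (mod 3 ^ (2 * l + 1))" using that Y by simp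
    have "(if B then 2 else 0) = (if \<delta> = 1 then 2 else 0 :: nat)"
      using notB B1 power_dvd_if_cong_unit[OF *, of \<delta>] l by auto
    moreover have "2 * l + 1 \<le> k" using l \<delta>_pos by auto
    ultimately show ?thesis using card_square_sols_unit[OF C _ _ *, of \<delta> k] n l by simp
  qed
  show "n = 2" if "\<delta> \<ge> 2" B
    using that n square_sols_empty_if_not_dvd[OF B2[rule_format] k, of C] by simp
  show "n = (if B then 2 else 0)" if "\<not> X" "\<forall>l\<in>{\<delta>..(k - 1) div 2}. \<not> Y l"
  proof -
    have "square_sols C A \<delta> k = {}"
      using that X Y by (intro square_sols_empty) auto
    then show ?thesis using n by simp
  qed
  show "n = (if B then 2 else 0)" if "\<not> X" "k < 2 * \<delta> - 1"
  proof -
    \<comment> \<open>For such \<open>k\<close> no \<open>l\<close> satisfies both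
      \<open>\<delta> \<le> l\<close> and \<open>2 * l < k\<close>, so only \<open>A\<close>
      vanishing modulo \<open>3 ^ k\<close> could admit solutions.\<close>
    have "square_sols C A \<delta> k = {}"
      using that X by (intro square_sols_empty) auto
    then show ?thesis using n by simp
  qed
qed

end

section \<open>Specialization to the ranges of \<open>\<delta>\<close> and \<open>k\<close>\<close>

theorem theorem1:
  fixes P :: int and \<delta> k :: nat
  assumes "\<not> 3 dvd P"
    and "\<delta> \<ge> 1"
    and "multiplicity 3 (P\<^sup>2 + 2) = \<delta>"
    and "k \<ge> 1"
  shows "(\<delta> = 1 \<longrightarrow>
          (\<forall>b::int.
           (cong_pm b (lucas_u P (2 * 3 ^ (2 * ((k - 1) div 4) + 1))) (3 ^ k) \<longrightarrow> v_u P (3 ^ k) b = 3 ^ (k div 2) + 2) \<and>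
           (\<forall>l\<in>{1..(k - 1) div 2}.
             cong_pm b (lucas_u P (2 * 3 ^ (l - 1))) (3 ^ (2 * l + 1)) \<longrightarrow>
             v_u P (3 ^ k) b = 2 * 3 ^ l + 2) \<and>
           (\<not> (cong_pm b (lucas_u P (2 * 3 ^ (2 * ((k - 1) div 4) + 1))) (3 ^ k)) \<and>
            \<not> (\<exists>l\<in>{1..(k - 1) div 2}.
                cong_pm b (lucas_u P (2 * 3 ^ (l - 1))) (3 ^ (2 * l + 1))) \<longrightarrow>
             v_u P (3 ^ k) b = 2)) \<and>
          (\<forall>b::int.
           (cong_pm b 2 (3 ^ k) \<longrightarrow> v_v P (3 ^ k) b = 3 ^ (k div 2) + 2) \<and>
           (\<forall>l\<in>{1..(k - 1) div 2}.
             cong_pm b (lucas_v P (4 * 3 ^ (l - 1))) (3 ^ (2 * l + 1)) \<longrightarrow>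
             v_v P (3 ^ k) b = 2 * 3 ^ l + 2) \<and>
           (\<not> (cong_pm b 2 (3 ^ k)) \<and>
            \<not> (\<exists>l\<in>{1..(k - 1) div 2}.
                cong_pm b (lucas_v P (4 * 3 ^ (l - 1))) (3 ^ (2 * l + 1))) \<longrightarrow>
             v_v P (3 ^ k) b = 2))) \<and>
         (\<delta> \<ge> 2 \<and> k \<ge> 2 * \<delta> - 1 \<longrightarrow>
          (\<forall>b::int.
           (cong_pm b (lucas_u P (2 * 3 ^ (2 * ((k + 1 - 2 * \<delta>) div 4) + 1))) (3 ^ k) \<longrightarrow> v_u P (3 ^ k) b = 3 ^ (k div 2)) \<and>
           (\<forall>l\<in>{\<delta>..(k - 1) div 2}.
             cong_pm b (lucas_u P (2 * 3 ^ (l - \<delta>))) (3 ^ (2 * l + 1)) \<longrightarrow>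
             v_u P (3 ^ k) b = 2 * 3 ^ l) \<and>
           ([b = 0] (mod 3 ^ \<delta>) \<or> cong_pm b 1 (3 ^ \<delta>) \<longrightarrow>
             v_u P (3 ^ k) b = 2) \<and>
           (\<not> (cong_pm b (lucas_u P (2 * 3 ^ (2 * ((k + 1 - 2 * \<delta>) div 4) + 1))) (3 ^ k)) \<and>
            \<not> (\<exists>l\<in>{\<delta>..(k - 1) div 2}.
                cong_pm b (lucas_u P (2 * 3 ^ (l - \<delta>))) (3 ^ (2 * l + 1))) \<and>
            \<not> ([b = 0] (mod 3 ^ \<delta>) \<or> cong_pm b 1 (3 ^ \<delta>)) \<longrightarrow>
             v_u P (3 ^ k) b = 0)) \<and>
          (\<forall>b::int.
           (cong_pm b 2 (3 ^ k) \<longrightarrow> v_v P (3 ^ k) b = 3 ^ (k div 2)) \<and>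
           (\<forall>l\<in>{\<delta>..(k - 1) div 2}.
             cong_pm b (lucas_v P (4 * 3 ^ (l - \<delta>))) (3 ^ (2 * l + 1)) \<longrightarrow>
             v_v P (3 ^ k) b = 2 * 3 ^ l) \<and>
           ([b = 0] (mod 3 ^ \<delta>) \<or> cong_pm b P (3 ^ \<delta>) \<longrightarrow>
             v_v P (3 ^ k) b = 2) \<and>
           (\<not> (cong_pm b 2 (3 ^ k)) \<and>
            \<not> (\<exists>l\<in>{\<delta>..(k - 1) div 2}.
                cong_pm b (lucas_v P (4 * 3 ^ (l - \<delta>))) (3 ^ (2 * l + 1))) \<and>
            \<not> ([b = 0] (mod 3 ^ \<delta>) \<or> cong_pm b P (3 ^ \<delta>)) \<longrightarrow>
             v_v P (3 ^ k) b = 0))) \<and>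
         (\<delta> \<ge> 2 \<and> \<delta> \<le> k \<and> k < 2 * \<delta> - 1 \<longrightarrow>
          (\<forall>b::int.
           (cong_pm b P (3 ^ k) \<longrightarrow> v_u P (3 ^ k) b = 3 ^ (k - \<delta>)) \<and>
           ([b = 0] (mod 3 ^ \<delta>) \<or> cong_pm b 1 (3 ^ \<delta>) \<longrightarrow>
             v_u P (3 ^ k) b = 2) \<and>
           (\<not> (cong_pm b P (3 ^ k)) \<and>
            \<not> ([b = 0] (mod 3 ^ \<delta>) \<or> cong_pm b 1 (3 ^ \<delta>)) \<longrightarrow>
             v_u P (3 ^ k) b = 0)) \<and>
          (\<forall>b::int.
           (cong_pm b 2 (3 ^ k) \<longrightarrow> v_v P (3 ^ k) b = 3 ^ (k - \<delta>)) \<and>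
           ([b = 0] (mod 3 ^ \<delta>) \<or> cong_pm b P (3 ^ \<delta>) \<longrightarrow>
             v_v P (3 ^ k) b = 2) \<and>
           (\<not> (cong_pm b 2 (3 ^ k)) \<and>
            \<not> ([b = 0] (mod 3 ^ \<delta>) \<or> cong_pm b P (3 ^ \<delta>)) \<longrightarrow>
             v_v P (3 ^ k) b = 0)))"
proof -
  \<comment> \<open>For a nonzero number \<open>multiplicity\<close> is the true exponent rather
    than a default value.\<close>
  have nz: "P\<^sup>2 + 2 \<noteq> 0" using zero_le_power2[of P] by linarith
  interpret lucas_3 P \<delta>
    using assms nz power_dvd_iff_le_multiplicity[of "P\<^sup>2 + 2" 3 \<delta>]
      power_dvd_iff_le_multiplicity[of "P\<^sup>2 + 2" 3 "\<delta> + 1"]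
    by unfold_locales simp_all
  \<comment> \<open>With \<open>e = 2 * ((k + 1 - 2 * \<delta>) div 4) + 1\<close>, rounding down
    loses at most 3, so \<open>2 * (\<delta> + e)\<close> is still at least \<open>k\<close>. For
    \<open>\<delta> = 1\<close> this is the exponent of the first case.\<close>
  have crit: "cong_pm b (u (2 * 3 ^ (2 * ((k + 1 - 2 * \<delta>) div 4) + 1))) (3 ^ k) \<longleftrightarrow> [D * b\<^sup>2 + 4 = 0] (mod 3 ^ k)" for b
    by (rule cong_pm_u_critical_iff) presburger
  \<comment> \<open>The exponent \<open>e = 0\<close> already suffices here, and
    \<open>u 2 = P\<close>.\<close>
  have critP: "cong_pm b P (3 ^ k) \<longleftrightarrow> [D * b\<^sup>2 + 4 = 0] (mod 3 ^ k)" if "k < 2 * \<delta> - 1" for b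
    using cong_pm_u_critical_iff[of k 0 b] that by (simp add: u_2)
  \<comment> \<open>Modulo 3 the residues 0, 1, -1, and likewise 0, \<open>P\<close>,
    \<open>- P\<close>, are all there are.\<close>
  have u_reg1: "\<delta> = 1 \<longrightarrow> [b = 0] (mod 3 ^ \<delta>) \<or> cong_pm b 1 (3 ^ \<delta>)"
    and v_reg1: "\<delta> = 1 \<longrightarrow> [b = 0] (mod 3 ^ \<delta>) \<or> cong_pm b P (3 ^ \<delta>)" for b
    using not_3_dvd_P unfolding cong_iff_dvd_diff by (simp, presburger)+
  have u_reg2: "\<delta> \<ge> 2 \<longrightarrow> [b = 0] (mod 3 ^ \<delta>) \<or> cong_pm b 1 (3 ^ \<delta>) \<longrightarrow> \<not> 3 ^ \<delta> dvd D * b\<^sup>2 + 4"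
    and v_reg2: "\<delta> \<ge> 2 \<longrightarrow> [b = 0] (mod 3 ^ \<delta>) \<or> cong_pm b P (3 ^ \<delta>) \<longrightarrow> \<not> 3 ^ \<delta> dvd b\<^sup>2 - 4" for b
    using not_power_dvd_discriminant_u not_power_dvd_discriminant_v by blast+
  have u_unit: "\<forall>l\<ge>\<delta>. cong_pm b (u (2 * 3 ^ (l - \<delta>))) (3 ^ (2 * l + 1)) \<longleftrightarrow>
      [D * b\<^sup>2 + 4 = 1 * 3 ^ (2 * l)] (mod 3 ^ (2 * l + 1))"
    and v_unit: "\<forall>l\<ge>\<delta>. cong_pm b (v (4 * 3 ^ (l - \<delta>))) (3 ^ (2 * l + 1)) \<longleftrightarrow>
      [b\<^sup>2 - 4 = D * 3 ^ (2 * l)] (mod 3 ^ (2 * l + 1))" for b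
    using cong_pm_u_unit_iff cong_pm_v_unit_iff by blast+
  have one: "\<not> 3 dvd (1::int)" by simp
  \<comment> \<open>The criterion for \<open>X\<close> is left open for u, because the critical
    residue is given by \<open>crit\<close> in the first two cases and by \<open>critP\<close> in
    the third.\<close>
  note U = count_cases[OF _ one v_u_eq u_reg1 u_reg2 _ u_unit]
  note V = count_cases[OF _ not_3_dvd_D v_v_eq v_reg1 v_reg2 cong_pm_v_critical_iff v_unit]
  show ?thesis
  \<comment> \<open>Goals 1 to 6 belong to \<open>\<delta> = 1\<close>, goals 7 to 14 to large
    \<open>k\<close> and goals 15 to 20 to small \<open>k\<close>; in each group the clauses for u
    precede those for v.\<close>
  proof (intro conjI impI allI ballI, goal_cases)
    case (1 b)
    then have k: "\<delta> \<le> k" using assms(4) by auto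
    show ?case using U(1)[OF k k crit, of b] 1 assms(4) by simp
  next
    case (2 b l)
    then have k: "\<delta> \<le> k" using assms(4) by auto
    show ?case using U(3)[OF k k crit, of l b] 2 assms(4) by simp
  next
    case (3 b)
    then have k: "\<delta> \<le> k" using assms(4) by auto
    show ?case using U(5)[OF k k crit, of b] u_reg1[of b] 3 assms(4) by simp
  next
    case (4 b)
    then have k: "\<delta> \<le> k" using assms(4) by auto
    show ?case using V(1)[OF k k, of b] 4 assms(4) by simp
  next
    case (5 b l)
    then have k: "\<delta> \<le> k" using assms(4) by auto
    show ?case using V(3)[OF k k, of l b] 5 assms(4) by simp
  next
    case (6 b)
    then have k: "\<delta> \<le> k" using assms(4) by auto
    show ?case using V(5)[OF k k, of b] v_reg1[of b] 6 assms(4) by simp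
  next
    case (7 b)
    then have k: "\<delta> \<le> k" using assms(4) by auto
    show ?case using U(1)[OF k k crit, of b] 7 assms(4) by simp
  next
    case (8 b l)
    then have k: "\<delta> \<le> k" using assms(4) by auto
    show ?case using U(3)[OF k k crit, of l b] 8 assms(4) by simp
  next
    case (9 b)
    then have k: "\<delta> \<le> k" using assms(4) by auto
    show ?case using U(4)[OF k k crit, of b] 9 assms(4) by simp
  next
    case (10 b)
    then have k: "\<delta> \<le> k" using assms(4) by auto
    show ?case using U(5)[OF k k crit, of b] 10 assms(4) by simp
  next
    case (11 b)
    then have k: "\<delta> \<le> k" using assms(4) by auto
    show ?case using V(1)[OF k k, of b] 11 assms(4) by simp
  next
    case (12 b l)
    then have k: "\<delta> \<le> k" using assms(4) by auto
    show ?case using V(3)[OF k k, of l b] 12 assms(4) by simp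
  next
    case (13 b)
    then have k: "\<delta> \<le> k" using assms(4) by auto
    show ?case using V(4)[OF k k, of b] 13 assms(4) by simp
  next
    case (14 b)
    then have k: "\<delta> \<le> k" using assms(4) by auto
    show ?case using V(5)[OF k k, of b] 14 assms(4) by simp
  next
    case (15 b)
    then have k: "\<delta> \<le> k" using assms(4) by auto
    show ?case using U(2)[OF k k critP, of b] 15 assms(4) by simp
  next
    case (16 b)
    then have k: "\<delta> \<le> k" using assms(4) by auto
    show ?case using U(4)[OF k k critP, of b] 16 assms(4) by simp
  next
    case (17 b)
    then have k: "\<delta> \<le> k" using assms(4) by auto
    show ?case using U(6)[OF k k critP, of b] 17 assms(4) by simp
  next
    case (18 b)
    then have k: "\<delta> \<le> k" using assms(4) by auto
    show ?case using V(2)[OF k k, of b] 18 assms(4) by simp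
  next
    case (19 b)
    then have k: "\<delta> \<le> k" using assms(4) by auto
    show ?case using V(4)[OF k k, of b] 19 assms(4) by simp
  next
    case (20 b)
    then have k: "\<delta> \<le> k" using assms(4) by auto
    show ?case using V(6)[OF k k, of b] 20 assms(4) by simp
  qed
qed

end
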